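(* There exist absolute constants $c>0$ and $c_1>c_2>0$ such that the following holds. For any $0<\delta<c$ there exist $n=n(\delta)\in\mathbb{N}$ and a nonempty set $S=S(\delta)\subset \mathbb{S}^{n-1}$ such that for every positive integer $m$, if $G\in\mathbb{R}^{m\times n}$ is a standard Gaussian matrix, then: (i) if $m\geq c_1\delta^{-3}w_*(S)^2$, then $G$ induces a $\delta$-uniform tessellation of $S$ with probability at least $0.99$; (ii) if $m\leq c_2\delta^{-3}w_*(S)^2$, then $G$ fails to induce a $\delta$-uniform tessellation of $S$ with probability at least $0.99$.
   Context: $\mathbb{S}^{n-1}$ is the Euclidean unit sphere in $\mathbb{R}^n$. A standard Gaussian matrix has i.i.d. $N(0,1)$ entries. For a nonempty set $T\subset\mathbb{R}^n$, its Gaussian complexity is $w_*(T):=\mathbb{E}\left(\sup_{x\in T}|\langle x,g\rangle|\right)$, where $g$ is a standard Gaussian vector in $\mathbb{R}^n$. For $v\in\mathbb{R}^m$, $\mathrm{sign}(v)\in\{-1,1\}^m$ is taken entrywise, with $\mathrm{sign}(t)=1$ for $t\ge 0$ and $\mathrm{sign}(t)=-1$ for $t<0$. For $a,b\in\{-1,1\}^m$, $d_H(a,b):=\frac1m\sum_{i=1}^m 1_{\{a_i\neq b_i\}}$ is the normalized Hamming distance. For $u,w\in\mathbb{S}^{n-1}$, $d_{\mathbb{S}^{n-1}}(u,w):=\frac1\pi\arccos(\langle u,w\rangle)$ is the normalized geodesic distance. For $S\subset\mathbb{S}^{n-1}$ and $\delta>0$, a matrix $G\in\mathbb{R}^{m\times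 n}$ induces a $\delta$-uniform tessellation of $S$ if, for all $x,y\in S$, $$\left|d_H(\mathrm{sign}(Gx),\mathrm{sign}(Gy))-d_{\mathbb{S}^{n-1}}(x,y)\right|\leq\delta.$$ *)

theory Defs
  imports "HOL-Probability.Probability"
begin

text \<open>
  The dimension is existentially quantified in the theorem, so it cannot be a type. A vector of
  dimension \<open>n\<close> is a function in \<open>{..<n} \<rightarrow>\<^sub>E UNIV\<close>, and an \<open>m \<times> n\<close> matrix is a function in
  \<open>{..<m} \<times> {..<n} \<rightarrow>\<^sub>E UNIV\<close>. These are exactly the spaces of the product measures below.
\<close>

definition dot :: "nat \<Rightarrow> (nat \<Rightarrow> real) \<Rightarrow> (nat \<Rightarrow> real) \<Rightarrow> real" where
  "dot n x y = (\<Sum>i<n. x i * y i)"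

definition unit_sphere :: "nat \<Rightarrow> (nat \<Rightarrow> real) set" where
  "unit_sphere n = {x \<in> {..<n} \<rightarrow>\<^sub>E UNIV. sqrt (dot n x x) = 1}"

definition mat_vec :: "nat \<Rightarrow> nat \<Rightarrow> (nat \<times> nat \<Rightarrow> real) \<Rightarrow> (nat \<Rightarrow> real) \<Rightarrow> (nat \<Rightarrow> real)" where
  "mat_vec m n G x = (\<lambda>i\<in>{..<m}. \<Sum>j<n. G (i, j) * x j)"

definition gaussian_vector :: "nat \<Rightarrow> (nat \<Rightarrow> real) measure" where
  "gaussian_vector n = (\<Pi>\<^sub>M i\<in>{..<n}. std_normal_distribution)"

definition gaussian_matrix :: "nat \<Rightarrow> nat \<Rightarrow> (nat \<times> nat \<Rightarrow> real) measure" where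
  "gaussian_matrix m n = (\<Pi>\<^sub>M p\<in>{..<m} \<times> {..<n}. std_normal_distribution)"

text \<open>
  The values lie in \<open>ennreal\<close>, so that neither the supremum nor the expectation takes a
  junk value when \<open>T\<close> is unbounded.
\<close>

definition gaussian_complexity :: "nat \<Rightarrow> (nat \<Rightarrow> real) set \<Rightarrow> ennreal" where
  "gaussian_complexity n T = (\<integral>\<^sup>+ g. (SUP x\<in>T. ennreal \<bar>dot n x g\<bar>) \<partial>gaussian_vector n)"

text \<open>Unlike \<^const>\<open>sgn\<close>, the sign of \<open>0\<close> is \<open>1\<close>.\<close>

definition sign1 :: "real \<Rightarrow> real" where
  "sign1 t = (if t \<ge> 0 then 1 else - 1)"

definition sign_vec :: "nat \<Rightarrow> (nat \<Rightarrow> real) \<Rightarrow> (nat \<Rightarrow> real)" where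
  "sign_vec m v = (\<lambda>i\<in>{..<m}. sign1 (v i))"

definition hamming_dist :: "nat \<Rightarrow> (nat \<Rightarrow> real) \<Rightarrow> (nat \<Rightarrow> real) \<Rightarrow> real" where
  "hamming_dist m a b = 1 / real m * (\<Sum>i<m. of_bool (a i \<noteq> b i))"

definition geodesic_dist :: "nat \<Rightarrow> (nat \<Rightarrow> real) \<Rightarrow> (nat \<Rightarrow> real) \<Rightarrow> real" where
  "geodesic_dist n u w = 1 / pi * arccos (dot n u w)"

definition uniform_tessellation ::
  "nat \<Rightarrow> nat \<Rightarrow> real \<Rightarrow> (nat \<Rightarrow> real) set \<Rightarrow> (nat \<times> nat \<Rightarrow> real) \<Rightarrow> bool" where
  "uniform_tessellation m n \<delta> S G \<longleftrightarrow>
    (\<forall>x\<in>S. \<forall>y\<in>S.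
      \<bar>hamming_dist m (sign_vec m (mat_vec m n G x)) (sign_vec m (mat_vec m n G y))
        - geodesic_dist n x y\<bar> \<le> \<delta>)"

end

theory Submission
  imports Defs
begin

text \<open>
  The witness is a narrow bundle of almost independent points. With \<open>e = \<delta>/16\<close>, let \<open>S\<close> consist of the
  pole \<open>e\<^sub>0\<close> and the spikes \<open>sqrt (1 - e\<^sup>2) e\<^sub>0 + e e\<^sub>j\<close> for \<open>1 \<le> j < n\<close>, where \<open>n\<close> is of order \<open>exp (A / \<delta>\<^sup>2)\<close>
  for a large absolute constant \<open>A\<close>. A spike is the pole plus a perturbation in its own private
  direction, so that, given the first column of \<open>G\<close>, the sign patterns of different spikes are
  independent. All points of \<open>S\<close> lie within geodesic distance \<open>\<delta>\<close> of each other. Hence uniform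
  tessellation is, up to a factor 2 in \<open>\<delta>\<close>, the statement that no spike is separated from the pole by
  a fraction of more than \<open>\<delta>\<close> of the rows.

  The Gaussian complexity of \<open>S\<close> lies between absolute constants. It is at least the mean of \<open>\<bar>g\<^sub>0\<bar>\<close>,
  and at most that mean plus \<open>e\<close> times the expected maximum of \<open>n - 1\<close> absolute Gaussians, which is
  of order \<open>sqrt (ln n)\<close>, that is, of order \<open>1/\<delta>\<close>. So the theorem asks for a transition at \<open>m\<close> of order
  \<open>\<delta>\<^sup>-\<^sup>3\<close>, which is \<open>ln n / \<delta>\<close> up to constants.

  Many rows (\<open>bouquet_tessellation_succeeds\<close>): a row separates a given spike from the pole only if
  \<open>\<bar>g\<^sub>0\<bar> \<le> 2e \<bar>g\<^sub>j\<bar>\<close>, which has probability at most \<open>\<delta>/8\<close>. By Chernoff's bound, more than \<open>\<delta>m/2\<close> rows do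
  so with probability at most \<open>exp (- \<delta>m/4)\<close>, and a union bound over the spikes costs only
  \<open>ln n\<close> in the exponent, a small multiple of \<open>\<delta>m\<close>.

  Few rows (\<open>bouquet_tessellation_fails\<close>): let \<open>r\<close> be the least integer above \<open>2\<delta>m\<close>. With high
  probability, \<open>r\<close> rows have \<open>\<bar>g\<^sub>0\<bar> \<le> \<tau>\<close>, where \<open>\<tau>\<close> is a multiple of \<open>\<delta>\<close> if \<open>\<delta>m\<close> is bounded below and a
  constant if \<open>r = 1\<close>. On these rows a given spike is separated from the pole as soon as
  \<open>\<bar>g\<^sub>j\<bar> \<ge> \<tau>/e\<close> with the sign opposite to that of \<open>g\<^sub>0\<close>. This happens in all \<open>r\<close> rows with probability at least
  \<open>exp (- r (3 + (\<tau>/e)\<^sup>2))\<close>, which is \<open>exp (- O(1/\<delta>\<^sup>2))\<close> in both cases. As the spikes are conditionally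
  independent and there are \<open>exp (A / \<delta>\<^sup>2)\<close> of them, one of them succeeds
  (\<open>not_uniform_tessellation_bouquet_prob\<close>).
\<close>

section \<open>Estimates for the standard normal distribution\<close>

interpretation std_normal: prob_space std_normal_distribution
  using prob_space_normal_density[of 1 0] by simp

lemma std_normal_prob_interval:
  fixes a b c :: real
  assumes "a \<le> b" "0 \<le> c"
  shows std_normal_prob_interval_ge:
      "(\<And>x. x \<in> {a..b} \<Longrightarrow> c \<le> std_normal_density x) \<Longrightarrow> c * (b - a) \<le> measure std_normal_distribution {a..b}"
    and std_normal_prob_interval_le:
      "(\<And>x. x \<in> {a..b} \<Longrightarrow> std_normal_density x \<le> c) \<Longrightarrow> measure std_normal_distribution {a..b} \<le> c * (b - a)"
proof -
  have eq: "ennreal (measure std_normal_distribution {a..b})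
      = (\<integral>\<^sup>+x. ennreal (std_normal_density x) * indicator {a..b} x \<partial>lborel)"
    by (subst std_normal.emeasure_eq_measure[symmetric]) (simp add: emeasure_density)
  have c: "(\<integral>\<^sup>+x. ennreal c * indicator {a..b} x \<partial>lborel) = ennreal (c * (b - a))"
    using assms by (simp add: nn_integral_cmult_indicator ennreal_mult)
  show "c * (b - a) \<le> measure std_normal_distribution {a..b}"
    if "\<And>x. x \<in> {a..b} \<Longrightarrow> c \<le> std_normal_density x"
  proof -
    have "ennreal (c * (b - a)) \<le> ennreal (measure std_normal_distribution {a..b})"
      unfolding eq c[symmetric] using that by (intro nn_integral_mono) (auto simp: indicator_def ennreal_leI)
    then show ?thesis by simp
  qed
  show "measure std_normal_distribution {a..b} \<le> c * (b - a)"
    if "\<And>x. x \<in> {a..b} \<Longrightarrow> std_normal_density x \<le> c"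
  proof -
    have "ennreal (measure std_normal_distribution {a..b}) \<le> ennreal (c * (b - a))"
      unfolding eq c[symmetric] using that by (intro nn_integral_mono) (auto simp: indicator_def ennreal_leI)
    then show ?thesis using assms by (simp add: ennreal_le_iff)
  qed
qed

lemma std_normal_density_bounds:
  shows "std_normal_density x \<le> 1 / 2" and "exp (- (x\<^sup>2 / 2)) / 3 \<le> std_normal_density x"
proof -
  have "2 \<le> sqrt (2 * pi)"
    using pi_gt3 by (intro real_le_rsqrt) simp
  then have "1 / sqrt (2 * pi) \<le> 1 / 2"
    by (intro divide_left_mono) auto
  then have "1 / sqrt (2 * pi) * exp (- (x\<^sup>2 / 2)) \<le> 1 / 2 * 1"
    by (intro mult_mono) auto
  then show "std_normal_density x \<le> 1 / 2"
    by (simp add: std_normal_density_def)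
  have "sqrt (2 * pi) \<le> 3"
    using pi_less_4 by (intro real_le_lsqrt) auto
  then have "1 / 3 \<le> 1 / sqrt (2 * pi)"
    by (intro divide_left_mono) auto
  then have "1 / 3 * exp (- (x\<^sup>2 / 2)) \<le> 1 / sqrt (2 * pi) * exp (- (x\<^sup>2 / 2))"
    by (intro mult_right_mono) auto
  then show "exp (- (x\<^sup>2 / 2)) / 3 \<le> std_normal_density x"
    by (simp add: std_normal_density_def)
qed

lemma std_normal_prob_abs_le:
  assumes "0 \<le> u"
  shows "measure std_normal_distribution {x. \<bar>x\<bar> \<le> u} \<le> u"
proof -
  have "{x. \<bar>x\<bar> \<le> u} = {-u..u}"
    by auto
  then show ?thesis
    using std_normal_prob_interval_le[of "-u" u "1/2"] assms std_normal_density_bounds(1) by simp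
qed

lemma std_normal_prob_abs_ge:
  assumes "0 \<le> u" "u \<le> 1"
  shows "u / 3 \<le> measure std_normal_distribution {x. \<bar>x\<bar> \<le> u}"
proof -
  have eq: "{x. \<bar>x\<bar> \<le> u} = {-u..u}"
    by auto
  have "1 / 6 \<le> std_normal_density x" if "x \<in> {-u..u}" for x
  proof -
    have "x\<^sup>2 \<le> 1"
      using that assms by (intro abs_square_le_1[THEN iffD2]) auto
    moreover have "1 + - (x\<^sup>2 / 2) \<le> exp (- (x\<^sup>2 / 2))"
      by (rule exp_ge_add_one_self)
    ultimately show ?thesis
      using std_normal_density_bounds(2)[of x] by simp
  qed
  then show ?thesis
    using std_normal_prob_interval_ge[of "- u" u "1 / 6"] assms unfolding eq by simp
qed

text \<open>
  The interval of length 1 beyond \<open>t\<close> already has this mass: there the exponent of the density is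
  at least \<open>- (t + 1)\<^sup>2 / 2 \<ge> - (1 + t\<^sup>2)\<close>, and \<open>exp (- 2)\<close> pays for the normalizing factor. Only the
  order of the exponent matters for the theorem.
\<close>
lemma std_normal_prob_tail_ge:
  assumes "0 \<le> t"
  shows "exp (- (3 + t\<^sup>2)) \<le> measure std_normal_distribution {t..}"
    and "exp (- (3 + t\<^sup>2)) \<le> measure std_normal_distribution {..-t}"
proof -
  define c where "c = exp (- (3 + t\<^sup>2))"
  have "exp (-1::real) \<le> 1 / 2"
    using exp_ge_add_one_self[of 1] by (simp add: exp_minus field_simps)
  then have "exp (-1::real) * exp (-1) \<le> 1 / 2 * (1 / 2)"
    by (intro mult_mono) auto
  then have e2: "exp (-2::real) \<le> 1 / 3"
    by (simp add: exp_add[symmetric])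
  have low: "c \<le> std_normal_density x" if "\<bar>x\<bar> \<le> t + 1" for x
  proof -
    have "x\<^sup>2 \<le> (t + 1)\<^sup>2"
      using that assms by (simp add: abs_le_square_iff[symmetric])
    also have "\<dots> \<le> 2 * t\<^sup>2 + 2"
      using sum_squares_bound[of t 1] by (simp add: power2_sum)
    finally have "exp (- (1 + t\<^sup>2)) \<le> exp (- (x\<^sup>2 / 2))"
      by simp
    then have "exp (-2) * exp (- (1 + t\<^sup>2)) \<le> 1 / 3 * exp (- (x\<^sup>2 / 2))"
      using e2 by (intro mult_mono) auto
    moreover have "c = exp (-2) * exp (- (1 + t\<^sup>2))"
      unfolding c_def by (simp add: exp_add[symmetric])
    ultimately show ?thesis
      using std_normal_density_bounds(2)[of x] by simp
  qed
  have c: "0 \<le> c"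
    by (simp add: c_def)
  have "c \<le> measure std_normal_distribution {t..t + 1}"
    using std_normal_prob_interval_ge[of t "t + 1" c] low c assms by simp
  also have "\<dots> \<le> measure std_normal_distribution {t..}"
    by (intro std_normal.finite_measure_mono) auto
  finally show "exp (- (3 + t\<^sup>2)) \<le> measure std_normal_distribution {t..}"
    by (simp add: c_def)
  have "c \<le> measure std_normal_distribution {- t - 1..- t}"
    using std_normal_prob_interval_ge[of "- t - 1" "- t" c] low c assms by simp
  also have "\<dots> \<le> measure std_normal_distribution {..- t}"
    by (intro std_normal.finite_measure_mono) auto
  finally show "exp (- (3 + t\<^sup>2)) \<le> measure std_normal_distribution {..-t}"
    by (simp add: c_def)
qed

text \<open>
  Completing the square: tilting the standard normal density by \<open>exp (s x)\<close> gives the normal density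
  with mean \<open>s\<close>, up to the factor \<open>exp (s\<^sup>2 / 2)\<close>.
\<close>
lemma std_normal_mgf:
  "(\<integral>\<^sup>+x. ennreal (exp (s * x)) \<partial>std_normal_distribution) = ennreal (exp (s\<^sup>2 / 2))"
proof -
  have "std_normal_density x * exp (s * x) = exp (s\<^sup>2 / 2) * normal_density s 1 x" for x
    by (simp add: normal_density_def exp_add[symmetric] power2_eq_square field_simps)
  then have "(\<integral>\<^sup>+x. ennreal (exp (s * x)) \<partial>std_normal_distribution)
      = (\<integral>\<^sup>+x. ennreal (exp (s\<^sup>2 / 2)) * ennreal (normal_density s 1 x) \<partial>lborel)"
    by (simp add: nn_integral_density ennreal_mult[symmetric])
  also have "\<dots> = ennreal (exp (s\<^sup>2 / 2))"
    using prob_space.emeasure_space_1[OF prob_space_normal_density[of 1 s]]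
    by (simp add: nn_integral_cmult emeasure_density)
  finally show ?thesis .
qed

lemma std_normal_abs_moment: "(\<integral>\<^sup>+x. ennreal \<bar>x\<bar> \<partial>std_normal_distribution) = ennreal (sqrt (2 / pi))"
proof -
  have "(\<integral>\<^sup>+x. ennreal \<bar>x\<bar> \<partial>std_normal_distribution) = (\<integral>\<^sup>+x. ennreal (std_normal_density x * \<bar>x\<bar>) \<partial>lborel)"
    by (simp add: nn_integral_density ennreal_mult)
  also have "\<dots> = ennreal (sqrt (2 / pi))"
    using std_normal_moment_abs_odd[of 0]
    by (subst nn_integral_eq_integral) (auto simp: has_bochner_integral_iff)
  finally show ?thesis .
qed

lemma std_normal_abs_moment_bounds: "1 / 2 \<le> sqrt (2 / pi)" "sqrt (2 / pi) \<le> 1"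
proof -
  show "1 / 2 \<le> sqrt (2 / pi)" using pi_less_4 by (intro real_le_rsqrt) (auto simp: field_simps power2_eq_square)
  show "sqrt (2 / pi) \<le> 1" using pi_gt3 by (intro real_le_lsqrt) auto
qed

lemma std_normal_prob_abs_gt:
  assumes "0 < u"
  shows "measure std_normal_distribution {x. u < \<bar>x\<bar>} \<le> 1 / u\<^sup>2"
proof -
  have "std_normal.expectation (\<lambda>x. x\<^sup>2) = 1"
    using std_normal_distribution_even_moments(1)[of 1] by simp
  moreover have "std_normal.prob {x \<in> space std_normal_distribution. u\<^sup>2 \<le> x\<^sup>2} \<le> std_normal.expectation (\<lambda>x. x\<^sup>2) / u\<^sup>2"
    using std_normal_distribution_even_moments(2)[of 1] assms
    by (intro integral_Markov_inequality_measure[where A="{}"]) auto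
  moreover have "measure std_normal_distribution {x. u < \<bar>x\<bar>} \<le> std_normal.prob {x \<in> space std_normal_distribution. u\<^sup>2 \<le> x\<^sup>2}"
    using assms by (intro std_normal.finite_measure_mono) (auto simp: abs_le_square_iff[symmetric])
  ultimately show ?thesis by simp
qed

section \<open>Independence of blocks and Chernoff bounds\<close>

lemma indep_vars_PiM_coordinates:
  assumes "\<And>i. i \<in> I \<Longrightarrow> prob_space (M i)"
  shows "prob_space.indep_vars (PiM I M) M (\<lambda>i \<omega>. \<omega> i) I"
proof -
  interpret prob_space "PiM I M"
    using assms by (rule prob_space_PiM)
  show ?thesis
  proof (cases "I = {}")
    case True
    then show ?thesis
      unfolding indep_vars_def indep_sets_def by auto
  next
    case False
    have "distr (PiM I M) (PiM I M) (\<lambda>x. \<lambda>i\<in>I. x i) = distr (PiM I M) (PiM I M) (\<lambda>x. x)"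
      by (intro distr_cong) (auto simp: space_PiM)
    also have "\<dots> = PiM I (\<lambda>i. distr (PiM I M) (M i) (\<lambda>\<omega>. \<omega> i))"
      using assms by (simp add: distr_PiM_component cong: PiM_cong)
    finally show ?thesis
      by (subst indep_vars_iff_distr_eq_PiM'[OF False]) auto
  qed
qed

text \<open>
  Functions of pairwise disjoint blocks of coordinates are independent. The locality assumption
  allows each function to be written on the whole space instead of on its block; the proof recovers the
  function on the block by filling the other coordinates with 0.
\<close>
lemma indep_vars_PiM_blocks:
  fixes I :: "'i set" and Q :: "'l \<Rightarrow> ('i \<Rightarrow> real) \<Rightarrow> 'b"
  defines "M \<equiv> \<Pi>\<^sub>M i\<in>I. std_normal_distribution"
  assumes K: "\<And>l. l \<in> L \<Longrightarrow> K l \<subseteq> I" "disjoint_family_on K L"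
    and Q: "\<And>l. l \<in> L \<Longrightarrow> Q l \<in> measurable M (N l)"
    and local: "\<And>l \<omega> \<omega>'. l \<in> L \<Longrightarrow> (\<And>i. i \<in> K l \<Longrightarrow> \<omega> i = \<omega>' i) \<Longrightarrow> Q l \<omega> = Q l \<omega>'"
  shows "prob_space.indep_vars M N Q L"
proof -
  interpret prob_space M
    unfolding M_def by (intro prob_space_PiM) unfold_locales
  define ext where "ext = (\<lambda>l \<eta>. \<lambda>i\<in>I. if i \<in> K l then \<eta> i else (0::real))"
  have ext: "ext l \<in> measurable (\<Pi>\<^sub>M i\<in>K l. std_normal_distribution) M" if "l \<in> L" for l
    unfolding ext_def M_def
  proof (intro measurable_restrict)
    fix i assume "i \<in> I"
    show "(\<lambda>\<eta>. if i \<in> K l then \<eta> i else 0)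
        \<in> measurable (\<Pi>\<^sub>M i\<in>K l. std_normal_distribution) std_normal_distribution"
      by (cases "i \<in> K l") auto
  qed
  have "indep_vars (\<lambda>_. std_normal_distribution) (\<lambda>i \<omega>. \<omega> i) I"
    unfolding M_def by (intro indep_vars_PiM_coordinates) unfold_locales
  from indep_vars_restrict[OF this K]
  have "indep_vars N (\<lambda>l \<omega>. Q l (ext l (restrict \<omega> (K l)))) L"
    by (rule indep_vars_compose2) (simp_all add: measurable_compose[OF ext Q])
  moreover have "Q l (ext l (restrict \<omega> (K l))) = Q l \<omega>" if "l \<in> L" for l \<omega>
    using K(1)[OF that] by (intro local[OF that]) (auto simp: ext_def)
  ultimately show ?thesis
    by (subst indep_vars_cong[OF refl _ refl]) auto
qed

lemma borel_measurable_card_Collect: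
  assumes "finite I" "\<And>i. i \<in> I \<Longrightarrow> Measurable.pred M (Q i)"
  shows "(\<lambda>\<omega>. real (card {i\<in>I. Q i \<omega>})) \<in> borel_measurable M"
proof -
  have "real (card {i\<in>I. Q i \<omega>}) = (\<Sum>i\<in>I. if Q i \<omega> then 1 else 0)" for \<omega>
    using assms(1) by (simp add: sum.If_cases Int_def)
  moreover have "(\<lambda>\<omega>. \<Sum>i\<in>I. if Q i \<omega> then 1 else 0 :: real) \<in> borel_measurable M"
    using assms(2) by (intro borel_measurable_sum measurable_If) auto
  ultimately show ?thesis by simp
qed

context prob_space
begin

lemma prob_all_indep:
  assumes "finite I" "indep_vars (\<lambda>_. count_space UNIV) Q I"
  shows "prob {\<omega>\<in>space M. \<forall>i\<in>I. Q i \<omega>} = (\<Prod>i\<in>I. prob {\<omega>\<in>space M. Q i \<omega>})"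
proof (cases "I = {}")
  case True
  then show ?thesis by (simp add: prob_space)
next
  case False
  have "prob (\<Inter>i\<in>I. Q i -` {True} \<inter> space M) = (\<Prod>i\<in>I. prob (Q i -` {True} \<inter> space M))"
    using assms False by (intro indep_varsD_finite) auto
  moreover have "(\<Inter>i\<in>I. Q i -` {True} \<inter> space M) = {\<omega>\<in>space M. \<forall>i\<in>I. Q i \<omega>}"
    using False by auto
  moreover have "Q i -` {True} \<inter> space M = {\<omega>\<in>space M. Q i \<omega>}" for i
    by auto
  ultimately show ?thesis by simp
qed

text \<open>
  The exponential of the count is a product of independent factors, with means
  \<open>1 + (exp s - 1) p\<^sub>i \<le> exp ((exp s - 1) p\<^sub>i)\<close>. The bound holds for either sign of \<open>s\<close>, so it gives both
  tails of the count.
\<close>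
lemma exp_moment_card:
  fixes Q :: "'i \<Rightarrow> 'a \<Rightarrow> bool" and s :: real
  assumes I: "finite I" and Q: "indep_vars (\<lambda>_. count_space UNIV) Q I"
  shows "(\<integral>\<^sup>+\<omega>. ennreal (exp (s * card {i\<in>I. Q i \<omega>})) \<partial>M)
    \<le> ennreal (exp ((exp s - 1) * (\<Sum>i\<in>I. prob {\<omega>\<in>space M. Q i \<omega>})))"
proof -
  define X where "X i \<omega> = (if Q i \<omega> then exp s else 1)" for i \<omega>
  have [measurable]: "Q i \<in> measurable M (count_space UNIV)" if "i \<in> I" for i
    using Q that by (auto simp: indep_vars_def)
  have "exp (s * card {i\<in>I. Q i \<omega>}) = (\<Prod>i\<in>I. X i \<omega>)" for \<omega>
  proof -
    have "(\<Prod>i\<in>I. X i \<omega>) = (\<Prod>i\<in>{i\<in>I. Q i \<omega>}. exp s)"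
      unfolding X_def by (rule prod.inter_filter[OF I, symmetric])
    then show ?thesis
      by (simp add: exp_of_nat_mult[symmetric] mult.commute)
  qed
  then have "(\<integral>\<^sup>+\<omega>. ennreal (exp (s * card {i\<in>I. Q i \<omega>})) \<partial>M) = (\<integral>\<^sup>+\<omega>. (\<Prod>i\<in>I. ennreal (X i \<omega>)) \<partial>M)"
    by (subst prod_ennreal) (auto simp: X_def)
  also have "\<dots> = (\<Prod>i\<in>I. \<integral>\<^sup>+\<omega>. ennreal (X i \<omega>) \<partial>M)"
  proof (rule indep_vars_nn_integral[OF I])
    show "indep_vars (\<lambda>_. borel) (\<lambda>i \<omega>. ennreal (X i \<omega>)) I"
      unfolding X_def by (rule indep_vars_compose2[OF Q]) auto
  qed auto
  also have "\<dots> = (\<Prod>i\<in>I. ennreal (1 + (exp s - 1) * prob {\<omega>\<in>space M. Q i \<omega>}))"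
  proof (intro prod.cong refl)
    fix i assume i[measurable]: "i \<in> I"
    have [measurable]: "X i \<in> borel_measurable M" "Measurable.pred M (Q i)"
      using i unfolding X_def by measurable
    have eq: "ennreal (X i \<omega>) = ennreal (exp s) * indicator {\<omega>\<in>space M. Q i \<omega>} \<omega>
        + indicator {\<omega>\<in>space M. \<not> Q i \<omega>} \<omega>" if "\<omega> \<in> space M" for \<omega>
      using that by (auto simp: X_def)
    have "(\<integral>\<^sup>+\<omega>. ennreal (X i \<omega>) \<partial>M)
        = ennreal (exp s) * emeasure M {\<omega>\<in>space M. Q i \<omega>} + emeasure M {\<omega>\<in>space M. \<not> Q i \<omega>}"
      by (simp add: eq nn_integral_add nn_integral_cmult cong: nn_integral_cong)
    also have "\<dots> = ennreal (exp s * prob {\<omega>\<in>space M. Q i \<omega>} + prob {\<omega>\<in>space M. \<not> Q i \<omega>})"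
      by (simp add: emeasure_eq_measure ennreal_mult ennreal_plus)
    also have "prob {\<omega>\<in>space M. \<not> Q i \<omega>} = 1 - prob {\<omega>\<in>space M. Q i \<omega>}"
      by (intro prob_neg) measurable
    finally show "(\<integral>\<^sup>+\<omega>. ennreal (X i \<omega>) \<partial>M) = ennreal (1 + (exp s - 1) * prob {\<omega>\<in>space M. Q i \<omega>})"
      by (simp add: algebra_simps)
  qed
  also have "\<dots> \<le> (\<Prod>i\<in>I. ennreal (exp ((exp s - 1) * prob {\<omega>\<in>space M. Q i \<omega>})))"
  proof -
    have "0 \<le> 1 + (exp s - 1) * prob {\<omega>\<in>space M. Q i \<omega>}" for i
    proof -
      have "0 \<le> exp s * prob {\<omega>\<in>space M. Q i \<omega>} + (1 - prob {\<omega>\<in>space M. Q i \<omega>})"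
        by (intro add_nonneg_nonneg) auto
      then show ?thesis
        by (simp add: algebra_simps)
    qed
    then show ?thesis
      by (simp add: prod_ennreal ennreal_leI prod_mono exp_ge_add_one_self)
  qed
  also have "\<dots> = ennreal (exp ((exp s - 1) * (\<Sum>i\<in>I. prob {\<omega>\<in>space M. Q i \<omega>})))"
    using I by (simp add: prod_ennreal exp_sum sum_distrib_left)
  finally show ?thesis .
qed

lemma prob_scaled_card_ge:
  fixes Q :: "'i \<Rightarrow> 'a \<Rightarrow> bool" and s t :: real
  assumes I: "finite I" and Q: "indep_vars (\<lambda>_. count_space UNIV) Q I"
  shows "prob {\<omega>\<in>space M. t \<le> s * card {i\<in>I. Q i \<omega>}}
    \<le> exp ((exp s - 1) * (\<Sum>i\<in>I. prob {\<omega>\<in>space M. Q i \<omega>}) - t)"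
proof -
  have [measurable]: "Measurable.pred M (Q i)" if "i \<in> I" for i
    using Q that by (auto simp: indep_vars_def)
  have [measurable]: "(\<lambda>\<omega>. real (card {i\<in>I. Q i \<omega>})) \<in> borel_measurable M"
    using I by (rule borel_measurable_card_Collect) fact
  have "ennreal (prob {\<omega>\<in>space M. t \<le> s * card {i\<in>I. Q i \<omega>}})
      = (\<integral>\<^sup>+\<omega>. indicator {\<omega>\<in>space M. t \<le> s * card {i\<in>I. Q i \<omega>}} \<omega> \<partial>M)"
    by (simp add: emeasure_eq_measure)
  also have "\<dots> \<le> (\<integral>\<^sup>+\<omega>. ennreal (exp (- t)) * ennreal (exp (s * card {i\<in>I. Q i \<omega>})) \<partial>M)"
    by (intro nn_integral_mono) (auto simp: indicator_def ennreal_mult[symmetric] exp_add[symmetric])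
  also have "\<dots> = ennreal (exp (- t)) * (\<integral>\<^sup>+\<omega>. ennreal (exp (s * card {i\<in>I. Q i \<omega>})) \<partial>M)"
    by (intro nn_integral_cmult) measurable
  also have "\<dots> \<le> ennreal (exp (- t)) * ennreal (exp ((exp s - 1) * (\<Sum>i\<in>I. prob {\<omega>\<in>space M. Q i \<omega>})))"
    by (intro mult_left_mono exp_moment_card[OF I Q]) auto
  finally show ?thesis
    by (simp add: ennreal_mult[symmetric] exp_add[symmetric] algebra_simps)
qed

text \<open>
  Chernoff's bound at \<open>s = 1\<close> for the upper tail, and below at \<open>s = -1\<close> for the lower tail. Fixed
  values of \<open>s\<close> suffice because \<open>u\<close> will be a fixed multiple of the mean.
\<close>
lemma prob_card_ge:
  fixes Q :: "'i \<Rightarrow> 'a \<Rightarrow> bool" and p u :: real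
  assumes "finite I" "indep_vars (\<lambda>_. count_space UNIV) Q I"
    and p: "\<And>i. i \<in> I \<Longrightarrow> prob {\<omega>\<in>space M. Q i \<omega>} \<le> p"
  shows "prob {\<omega>\<in>space M. u \<le> card {i\<in>I. Q i \<omega>}} \<le> exp (2 * p * card I - u)"
proof -
  have "(\<Sum>i\<in>I. prob {\<omega>\<in>space M. Q i \<omega>}) \<le> card I * p"
    using p by (intro sum_bounded_above) auto
  then have "(exp 1 - 1) * (\<Sum>i\<in>I. prob {\<omega>\<in>space M. Q i \<omega>}) \<le> 2 * (card I * p)"
    using exp_le by (intro mult_mono sum_nonneg) auto
  then show ?thesis
    using prob_scaled_card_ge[OF assms(1,2), of u 1] by (simp add: mult_ac order.trans)
qed

lemma prob_card_le:
  fixes Q :: "'i \<Rightarrow> 'a \<Rightarrow> bool" and p u :: real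
  assumes "finite I" "indep_vars (\<lambda>_. count_space UNIV) Q I"
    and p: "\<And>i. i \<in> I \<Longrightarrow> p \<le> prob {\<omega>\<in>space M. Q i \<omega>}"
  shows "prob {\<omega>\<in>space M. card {i\<in>I. Q i \<omega>} \<le> u} \<le> exp (u - p * card I / 2)"
proof -
  have "card I * p \<le> (\<Sum>i\<in>I. prob {\<omega>\<in>space M. Q i \<omega>})"
    using p by (intro sum_bounded_below) auto
  moreover have "exp (-1) \<le> (1::real) / 2"
    using exp_ge_add_one_self[of 1] by (simp add: exp_minus field_simps)
  moreover have "0 \<le> (\<Sum>i\<in>I. prob {\<omega>\<in>space M. Q i \<omega>})"
    by (intro sum_nonneg) auto
  ultimately have "(exp (-1) - 1) * (\<Sum>i\<in>I. prob {\<omega>\<in>space M. Q i \<omega>}) \<le> (- 1 / 2) * (\<Sum>i\<in>I. prob {\<omega>\<in>space M. Q i \<omega>})"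
    by (intro mult_right_mono) auto
  with \<open>card I * p \<le> _\<close> have "(exp (-1) - 1) * (\<Sum>i\<in>I. prob {\<omega>\<in>space M. Q i \<omega>}) + u \<le> u - p * card I / 2"
    by (simp add: mult.commute)
  then show ?thesis
    using prob_scaled_card_ge[OF assms(1,2), of "-u" "-1"]
    by (simp add: order.trans)
qed

end

section \<open>Entries of Gaussian matrices\<close>

lemma prob_space_gaussian:
  "prob_space (gaussian_vector n)" "prob_space (gaussian_matrix m n)"
  unfolding gaussian_vector_def gaussian_matrix_def by (intro prob_space_PiM; unfold_locales)+

lemma measurable_gaussian_entry:
  "p \<in> {..<m} \<times> {..<n} \<Longrightarrow> (\<lambda>G. G p) \<in> borel_measurable (gaussian_matrix m n)"
  "i < n \<Longrightarrow> (\<lambda>g. g i) \<in> borel_measurable (gaussian_vector n)"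
  unfolding gaussian_matrix_def gaussian_vector_def by measurable

lemma distr_gaussian_entry:
  shows "p \<in> {..<m} \<times> {..<n} \<Longrightarrow> distr (gaussian_matrix m n) borel (\<lambda>G. G p) = std_normal_distribution"
    and "i < n \<Longrightarrow> distr (gaussian_vector n) borel (\<lambda>g. g i) = std_normal_distribution"
proof -
  have P: "prob_space std_normal_distribution" by unfold_locales
  show "p \<in> {..<m} \<times> {..<n} \<Longrightarrow> distr (gaussian_matrix m n) borel (\<lambda>G. G p) = std_normal_distribution"
    using distr_PiM_component[of "{..<m} \<times> {..<n}" "\<lambda>_. std_normal_distribution" p] P
    unfolding gaussian_matrix_def by (simp add: distr_cong[OF refl _ refl, of borel std_normal_distribution])
  show "i < n \<Longrightarrow> distr (gaussian_vector n) borel (\<lambda>g. g i) = std_normal_distribution"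
    using distr_PiM_component[of "{..<n}" "\<lambda>_. std_normal_distribution" i] P
    unfolding gaussian_vector_def by (simp add: distr_cong[OF refl _ refl, of borel std_normal_distribution])
qed

lemma gaussian_matrix_entry_prob:
  assumes "p \<in> {..<m} \<times> {..<n}" "A \<in> sets borel"
  shows "measure (gaussian_matrix m n) {G \<in> space (gaussian_matrix m n). G p \<in> A} = measure std_normal_distribution A"
proof -
  have "measure (distr (gaussian_matrix m n) borel (\<lambda>G. G p)) A
      = measure (gaussian_matrix m n) ((\<lambda>G. G p) -` A \<inter> space (gaussian_matrix m n))"
    using assms(2) by (intro measure_distr measurable_gaussian_entry(1)[OF assms(1)]) auto
  then show ?thesis
    using assms by (simp add: distr_gaussian_entry vimage_def Int_def conj_commute)
qed

text \<open>
  Given the entry at \<open>q\<close>, the entry at \<open>p\<close> must fall into an interval of radius \<open>s \<bar>G q\<bar>\<close>, which has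
  probability at most \<open>s \<bar>G q\<bar>\<close>. Averaging uses only that the first absolute moment is at most 1.
\<close>
lemma gaussian_matrix_ratio_prob:
  assumes p: "p \<in> {..<m} \<times> {..<n}" and q: "q \<in> {..<m} \<times> {..<n}" and "p \<noteq> q" and s: "0 \<le> s"
  shows "measure (gaussian_matrix m n) {G \<in> space (gaussian_matrix m n). \<bar>G p\<bar> \<le> s * \<bar>G q\<bar>} \<le> s"
proof -
  interpret prob_space "gaussian_matrix m n" by (rule prob_space_gaussian)
  let ?N = "std_normal_distribution"
  let ?M = "gaussian_matrix m n"
  note [measurable] = measurable_gaussian_entry(1)[OF p] measurable_gaussian_entry(1)[OF q]
  have "indep_var borel (\<lambda>G. G q) borel (\<lambda>G. G p)"
    unfolding indep_var_def unfolding gaussian_matrix_def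
  proof (rule indep_vars_PiM_blocks[where K="case_bool {q} {p}"])
    show "disjoint_family_on (case_bool {q} {p}) (UNIV :: bool set)"
      using \<open>p \<noteq> q\<close> by (auto simp: disjoint_family_on_def split: bool.split)
    show "case_bool (\<lambda>G. G q) (\<lambda>G. G p) l
        \<in> measurable (Pi\<^sub>M ({..<m} \<times> {..<n}) (\<lambda>p. std_normal_distribution)) (case_bool borel borel l)" for l
      using measurable_gaussian_entry(1)[OF p] measurable_gaussian_entry(1)[OF q]
      by (cases l) (simp_all add: gaussian_matrix_def)
  qed (use p q in \<open>auto split: bool.splits\<close>)
  then have joint: "distr ?M (borel \<Otimes>\<^sub>M borel) (\<lambda>G. (G q, G p)) = distr ?M borel (\<lambda>G. G q) \<Otimes>\<^sub>M distr ?M borel (\<lambda>G. G p)"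
    by (simp add: indep_var_distribution_eq)
  define A where "A = {x :: real \<times> real. \<bar>snd x\<bar> \<le> s * \<bar>fst x\<bar>}"
  have "closed A"
    unfolding A_def by (intro closed_Collect_le continuous_intros)
  then have [measurable]: "A \<in> sets (borel \<Otimes>\<^sub>M borel)"
    unfolding borel_prod by (rule borel_closed)
  have "emeasure ?M {G \<in> space ?M. \<bar>G p\<bar> \<le> s * \<bar>G q\<bar>} = emeasure (distr ?M (borel \<Otimes>\<^sub>M borel) (\<lambda>G. (G q, G p))) A"
  proof -
    have "emeasure (distr ?M (borel \<Otimes>\<^sub>M borel) (\<lambda>G. (G q, G p))) A = emeasure ?M ((\<lambda>G. (G q, G p)) -` A \<inter> space ?M)"
      by (rule emeasure_distr) measurable
    also have "(\<lambda>G. (G q, G p)) -` A \<inter> space ?M = {G \<in> space ?M. \<bar>G p\<bar> \<le> s * \<bar>G q\<bar>}"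
      by (auto simp: A_def)
    finally show ?thesis ..
  qed
  also have "\<dots> = emeasure (?N \<Otimes>\<^sub>M ?N) A"
    unfolding joint using p q by (simp add: distr_gaussian_entry)
  also have "\<dots> = (\<integral>\<^sup>+y. emeasure ?N (Pair y -` A) \<partial>?N)"
    by (rule std_normal.emeasure_pair_measure_alt) simp
  also have "\<dots> \<le> (\<integral>\<^sup>+y. ennreal s * ennreal \<bar>y\<bar> \<partial>?N)"
  proof (intro nn_integral_mono)
    fix y :: real
    have "Pair y -` A = {x. \<bar>x\<bar> \<le> s * \<bar>y\<bar>}"
      by (auto simp: A_def)
    then have "emeasure ?N (Pair y -` A) \<le> ennreal (s * \<bar>y\<bar>)"
      using std_normal_prob_abs_le[of "s * \<bar>y\<bar>"] s by (simp add: std_normal.emeasure_eq_measure ennreal_leI)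
    then show "emeasure ?N (Pair y -` A) \<le> ennreal s * ennreal \<bar>y\<bar>"
      using s by (simp add: ennreal_mult)
  qed
  also have "\<dots> = ennreal s * ennreal (sqrt (2 / pi))"
    by (subst nn_integral_cmult) (auto simp: std_normal_abs_moment)
  also have "\<dots> \<le> ennreal s * 1"
    using std_normal_abs_moment_bounds(2) by (intro mult_left_mono) (auto simp: ennreal_le_1)
  finally show ?thesis
    using s by (simp add: emeasure_eq_measure)
qed

section \<open>Separating rows\<close>

definition separated :: "nat \<Rightarrow> nat \<Rightarrow> (nat \<Rightarrow> real) \<Rightarrow> (nat \<Rightarrow> real) \<Rightarrow> (nat \<times> nat \<Rightarrow> real) \<Rightarrow> nat set" where
  "separated m n x y G =
    {i\<in>{..<m}. sign1 (dot n x (\<lambda>j. G (i, j))) \<noteq> sign1 (dot n y (\<lambda>j. G (i, j)))}"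

lemma finite_separated [simp]: "finite (separated m n x y G)"
  by (simp add: separated_def)

lemma hamming_dist_eq_card_separated:
  "hamming_dist m (sign_vec m (mat_vec m n G x)) (sign_vec m (mat_vec m n G y))
    = card (separated m n x y G) / m"
proof -
  have "(\<Sum>i<m. of_bool (sign_vec m (mat_vec m n G x) i \<noteq> sign_vec m (mat_vec m n G y) i))
      = (\<Sum>i<m. of_bool (i \<in> separated m n x y G) :: real)"
    by (intro sum.cong) (auto simp: separated_def sign_vec_def mat_vec_def dot_def mult.commute)
  also have "\<dots> = card ({..<m} \<inter> separated m n x y G)"
    by simp
  also have "{..<m} \<inter> separated m n x y G = separated m n x y G"
    by (auto simp: separated_def)
  finally show ?thesis
    by (simp add: hamming_dist_def)
qed

lemma card_separated_triangle:
  "card (separated m n x y G) \<le> card (separated m n z x G) + card (separated m n z y G)"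
proof -
  have "separated m n x y G \<subseteq> separated m n z x G \<union> separated m n z y G"
    by (auto simp: separated_def)
  then have "card (separated m n x y G) \<le> card (separated m n z x G \<union> separated m n z y G)"
    by (intro card_mono) auto
  then show ?thesis
    using card_Un_le order.trans by blast
qed

text \<open>
  In a set of geodesic diameter at most \<open>\<delta>\<close> the geodesic term cannot spoil the comparison, since
  both distances lie in \<open>[0, \<delta>]\<close>. The triangle inequality for separating rows then reduces pairs to
  comparisons with one base point \<open>z\<close>, at the price of the factor 2.
\<close>
lemma uniform_tessellation_narrowI:
  assumes m: "0 < m"
    and geo: "\<And>x y. x \<in> S \<Longrightarrow> y \<in> S \<Longrightarrow> 0 \<le> geodesic_dist n x y \<and> geodesic_dist n x y \<le> \<delta>"
    and sep: "\<And>x. x \<in> S \<Longrightarrow> card (separated m n z x G) \<le> \<delta> * m / 2"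
  shows "uniform_tessellation m n \<delta> S G"
  unfolding uniform_tessellation_def hamming_dist_eq_card_separated
proof (intro ballI)
  fix x y assume xy: "x \<in> S" "y \<in> S"
  have "real (card (separated m n x y G)) \<le> card (separated m n z x G) + card (separated m n z y G)"
    using card_separated_triangle[of m n x y G z] by linarith
  also have "\<dots> \<le> \<delta> * m"
    using sep[OF xy(1)] sep[OF xy(2)] by simp
  finally have "card (separated m n x y G) / m \<le> \<delta>"
    using m by (simp add: divide_le_eq)
  moreover have "0 \<le> card (separated m n x y G) / m"
    by simp
  ultimately show "\<bar>card (separated m n x y G) / m - geodesic_dist n x y\<bar> \<le> \<delta>"
    using geo[OF xy] by linarith
qed

lemma not_uniform_tessellationI:
  assumes "x \<in> S" "y \<in> S" "0 < m" "geodesic_dist n x y \<le> \<delta>"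
    and "2 * \<delta> * real m < real (card (separated m n x y G))"
  shows "\<not> uniform_tessellation m n \<delta> S G"
proof -
  have "2 * \<delta> < card (separated m n x y G) / m"
    using assms by (simp add: less_divide_eq)
  then have "\<not> \<bar>card (separated m n x y G) / m - geodesic_dist n x y\<bar> \<le> \<delta>"
    using assms(4) by linarith
  then show ?thesis
    unfolding uniform_tessellation_def hamming_dist_eq_card_separated using assms(1,2) by blast
qed

lemma pred_uniform_tessellation:
  assumes S: "finite S"
  shows "Measurable.pred (gaussian_matrix m n) (uniform_tessellation m n \<delta> S)"
proof -
  have [measurable]: "(\<lambda>G. dot n x (\<lambda>j. G (i, j))) \<in> borel_measurable (gaussian_matrix m n)" if "i \<in> {..<m}" for i x
    unfolding dot_def using that by (intro borel_measurable_sum borel_measurable_times measurable_gaussian_entry) auto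
  have sign: "sign1 \<in> borel_measurable borel"
    unfolding sign1_def[abs_def] by measurable
  have [measurable]: "Measurable.pred (gaussian_matrix m n)
      (\<lambda>G. sign1 (dot n x (\<lambda>j. G (i, j))) \<noteq> sign1 (dot n y (\<lambda>j. G (i, j))))" if "i \<in> {..<m}" for i x y
    unfolding pred_def using that
    by (intro borel_measurable_neq measurable_compose[OF _ sign]) measurable
  have [measurable]: "(\<lambda>G. real (card (separated m n x y G))) \<in> borel_measurable (gaussian_matrix m n)" for x y
    unfolding separated_def by (rule borel_measurable_card_Collect[OF finite_lessThan]) measurable
  show ?thesis
    unfolding uniform_tessellation_def hamming_dist_eq_card_separated using S
    by (intro pred_intros_finite) measurable
qed

section \<open>The bouquet: a pole and its spikes\<close>

text \<open>
  The set \<open>S\<close> of the theorem: coordinate 0 is the common axis, and each spike has a coordinate of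
  its own.
\<close>
definition pole :: "nat \<Rightarrow> nat \<Rightarrow> real" where
  "pole n = (\<lambda>i\<in>{..<n}. if i = 0 then 1 else 0)"

definition spike :: "real \<Rightarrow> nat \<Rightarrow> nat \<Rightarrow> nat \<Rightarrow> real" where
  "spike e n j = (\<lambda>i\<in>{..<n}. if i = 0 then sqrt (1 - e\<^sup>2) else if i = j then e else 0)"

definition bouquet :: "real \<Rightarrow> nat \<Rightarrow> (nat \<Rightarrow> real) set" where
  "bouquet e n = insert (pole n) (spike e n ` {1..<n})"

lemma pole_apply: "i < n \<Longrightarrow> pole n i = (if i = 0 then 1 else 0)"
  by (simp add: pole_def)

lemma spike_apply: "i < n \<Longrightarrow> spike e n j i = (if i = 0 then sqrt (1 - e\<^sup>2) else if i = j then e else 0)"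
  by (simp add: spike_def)

lemma dot_pole: "0 < n \<Longrightarrow> dot n (pole n) g = g 0"
proof -
  assume "0 < n"
  have "dot n (pole n) g = (\<Sum>i<n. if i = 0 then g i else 0)"
    unfolding dot_def pole_def by (intro sum.cong) auto
  also have "\<dots> = g 0"
    using \<open>0 < n\<close> by (simp add: sum.delta)
  finally show ?thesis .
qed

lemma dot_spike:
  assumes "0 < j" "j < n"
  shows "dot n (spike e n j) g = sqrt (1 - e\<^sup>2) * g 0 + e * g j"
proof -
  have "dot n (spike e n j) g = (\<Sum>i<n. (if i = 0 then sqrt (1 - e\<^sup>2) * g i else 0) + (if i = j then e * g i else 0))"
    unfolding dot_def spike_def using assms by (intro sum.cong) auto
  also have "\<dots> = sqrt (1 - e\<^sup>2) * g 0 + e * g j"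
    using assms by (simp add: sum.distrib sum.delta)
  finally show ?thesis .
qed

lemma finite_bouquet: "finite (bouquet e n)"
  by (simp add: bouquet_def)

lemma bouquet_subset_unit_sphere:
  assumes "0 < n" "\<bar>e\<bar> \<le> 1"
  shows "bouquet e n \<subseteq> unit_sphere n"
proof -
  have "pole n \<in> unit_sphere n"
    unfolding unit_sphere_def using assms dot_pole[of n "pole n"] by (auto simp: pole_def)
  moreover have "spike e n j \<in> unit_sphere n" if "j \<in> {1..<n}" for j
  proof -
    have "0 \<le> 1 - e\<^sup>2"
      using assms by (simp add: abs_square_le_1)
    then have "dot n (spike e n j) (spike e n j) = 1"
      using that by (simp add: dot_spike spike_apply power2_eq_square[symmetric])
    moreover have "spike e n j \<in> {..<n} \<rightarrow>\<^sub>E UNIV"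
      by (simp add: spike_def)
    ultimately show ?thesis
      by (simp add: unit_sphere_def)
  qed
  ultimately show ?thesis
    by (auto simp: bouquet_def)
qed

lemma cos_le_quadratic:
  fixes x :: real
  assumes "0 \<le> x" "x \<le> 1"
  shows "cos x \<le> 1 - x\<^sup>2 / 8"
proof -
  have "\<bar>sin (x / 2) - x / 2\<bar> \<le> (x / 2)\<^sup>2 / 2"
    using Maclaurin_sin_bound[of "x / 2" 2] by (simp add: sin_coeff_def numeral_2_eq_2)
  moreover have "(x / 2)\<^sup>2 / 2 \<le> x / 4"
    using assms mult_left_mono[of x 1 x] by (simp add: power2_eq_square)
  ultimately have "x / 4 \<le> sin (x / 2)"
    by linarith
  then have "(x / 4)\<^sup>2 \<le> (sin (x / 2))\<^sup>2"
    using assms by (intro power_mono) auto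
  then show ?thesis
    using cos_double_sin[of "x / 2"] by (simp add: power2_eq_square)
qed

lemma arccos_le_of_near_1:
  fixes x t :: real
  assumes "0 \<le> x" "x \<le> 1" "1 - x\<^sup>2 / 8 \<le> t" "t \<le> 1"
  shows "arccos t \<le> x"
proof -
  have "arccos t \<le> arccos (cos x)"
    using assms cos_le_quadratic[OF assms(1,2)] by (intro arccos_le_arccos) auto
  also have "\<dots> = x"
    using assms pi_gt3 by (intro arccos_cos) auto
  finally show ?thesis .
qed

text \<open>
  All inner products in the bouquet are at least \<open>1 - e\<^sup>2\<close>, and this is at least
  \<open>1 - \<delta>\<^sup>2 / 8 \<ge> cos \<delta>\<close>.
\<close>
lemma bouquet_geodesic_dist:
  assumes n: "0 < n" and e: "0 \<le> e" "4 * e \<le> \<delta>" and \<delta>: "\<delta> \<le> 1"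
    and xy: "x \<in> bouquet e n" "y \<in> bouquet e n"
  shows "0 \<le> geodesic_dist n x y \<and> geodesic_dist n x y \<le> \<delta>"
proof -
  have e1: "e\<^sup>2 \<le> 1"
    using e \<delta> by (intro power_le_one) auto
  have ed: "e\<^sup>2 \<le> \<delta>\<^sup>2 / 16"
    using power_mono[of "4 * e" \<delta> 2] e by (simp add: power2_eq_square)
  define a where "a = sqrt (1 - e\<^sup>2)"
  have a: "a\<^sup>2 = 1 - e\<^sup>2" "0 \<le> a" "a \<le> 1"
    using e1 by (auto simp: a_def)
  have a': "1 - e\<^sup>2 \<le> a"
    using a mult_left_mono[of a 1 a] by (simp add: power2_eq_square)
  have dot: "1 - e\<^sup>2 \<le> dot n x y \<and> dot n x y \<le> 1"
  proof (cases "x = pole n")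
    case True
    then show ?thesis
      using xy(2) n a a' by (auto simp: bouquet_def dot_pole pole_apply spike_apply a_def)
  next
    case False
    then obtain j where j: "x = spike e n j" "0 < j" "j < n"
      using xy(1) by (auto simp: bouquet_def)
    then have "dot n x y = a * y 0 + e * y j"
      by (simp add: dot_spike a_def)
    then show ?thesis
      using xy(2) n j a a' e by (auto simp: bouquet_def pole_apply spike_apply a_def[symmetric] power2_eq_square[symmetric])
  qed
  have "0 \<le> arccos (dot n x y)"
    using dot e1 by (intro arccos_lbound) auto
  moreover have "arccos (dot n x y) \<le> \<delta>"
    using dot e \<delta> ed by (intro arccos_le_of_near_1) auto
  moreover have "\<delta> \<le> \<delta> * pi"
    using pi_gt3 e by (simp add: mult_le_cancel_left1)
  ultimately show ?thesis
    by (auto simp: geodesic_dist_def divide_le_eq)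
qed

text \<open>
  The perturbation can change the sign of \<open>sqrt (1 - e\<^sup>2) G (i, 0)\<close> only if it is at least as large, and
  \<open>sqrt (1 - e\<^sup>2) \<ge> 1 / 2\<close>.
\<close>
lemma separated_pole_spike_imp_ratio:
  assumes j: "0 < j" "j < n" and e: "0 \<le> e" "e \<le> 1 / 2"
    and i: "i \<in> separated m n (pole n) (spike e n j) G"
  shows "\<bar>G (i, 0)\<bar> \<le> 2 * e * \<bar>G (i, j)\<bar>"
proof (rule ccontr)
  assume "\<not> ?thesis"
  then have less: "2 * (e * \<bar>G (i, j)\<bar>) < \<bar>G (i, 0)\<bar>"
    by simp
  have "e\<^sup>2 \<le> (1 / 2)\<^sup>2"
    using e by (intro power_mono) auto
  define a where "a = sqrt (1 - e\<^sup>2)"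
  have a: "1 / 2 \<le> a"
    unfolding a_def using \<open>e\<^sup>2 \<le> _\<close> by (intro real_le_rsqrt) (simp add: power2_eq_square)
  then have "1 / 2 * \<bar>G (i, 0)\<bar> \<le> a * \<bar>G (i, 0)\<bar>"
    by (intro mult_right_mono) auto
  moreover have "\<bar>a * G (i, 0)\<bar> = a * \<bar>G (i, 0)\<bar>"
    unfolding abs_mult using a by simp
  moreover have "\<bar>e * G (i, j)\<bar> = e * \<bar>G (i, j)\<bar>"
    using e by (simp add: abs_mult)
  ultimately have "\<bar>e * G (i, j)\<bar> < \<bar>a * G (i, 0)\<bar>"
    using less by linarith
  moreover have "0 \<le> a * G (i, 0) \<longleftrightarrow> 0 \<le> G (i, 0)"
    using a by (auto simp: zero_le_mult_iff)
  ultimately have "sign1 (G (i, 0)) = sign1 (a * G (i, 0) + e * G (i, j))"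
    unfolding sign1_def by (cases "0 \<le> G (i, 0)"; simp; linarith)
  then show False
    using i j by (simp add: separated_def dot_pole dot_spike a_def)
qed

text \<open>
  The sufficient condition on column \<open>j\<close> depends on column 0 only through the sign of \<open>G (i, 0)\<close> and
  the knowledge that it is small. This makes it possible to condition on finitely many patterns of
  column 0.
\<close>
lemma separated_pole_spikeI:
  assumes j: "0 < j" "j < n" and e: "0 < e" "e \<le> 1" and i: "i < m"
    and \<tau>: "0 < \<tau>" "\<bar>G (i, 0)\<bar> \<le> \<tau>"
    and flip: "if 0 \<le> G (i, 0) then G (i, j) \<le> - (\<tau> / e) else \<tau> / e \<le> G (i, j)"
  shows "i \<in> separated m n (pole n) (spike e n j) G"
proof -
  define a where "a = sqrt (1 - e\<^sup>2)"
  have a: "0 \<le> a" "a < 1"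
    using e by (auto simp: a_def power_le_one)
  have "a * \<bar>G (i, 0)\<bar> \<le> a * \<tau>"
    using a \<tau> by (intro mult_left_mono) auto
  also have "\<dots> < \<tau>"
    using a \<tau> by simp
  finally have *: "a * \<bar>G (i, 0)\<bar> < \<tau>" .
  have "sign1 (G (i, 0)) \<noteq> sign1 (a * G (i, 0) + e * G (i, j))"
  proof (cases "0 \<le> G (i, 0)")
    case True
    then have "e * G (i, j) \<le> - \<tau>"
      using flip e by (simp add: field_simps)
    then show ?thesis
      using * True by (simp add: sign1_def)
  next
    case False
    then have "\<tau> \<le> e * G (i, j)"
      using flip e by (simp add: field_simps)
    then show ?thesis
      using * False by (simp add: sign1_def)
  qed
  then show ?thesis
    using i j by (simp add: separated_def dot_pole dot_spike a_def)
qed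

section \<open>Gaussian complexity of the bouquet\<close>

lemma gaussian_complexity_bouquet_ge:
  assumes "0 < n"
  shows "ennreal (1 / 2) \<le> gaussian_complexity n (bouquet e n)"
proof -
  have "ennreal (1 / 2) \<le> ennreal (sqrt (2 / pi))"
    using std_normal_abs_moment_bounds by (intro ennreal_leI) auto
  also have "\<dots> = (\<integral>\<^sup>+x. ennreal \<bar>x\<bar> \<partial>distr (gaussian_vector n) borel (\<lambda>g. g 0))"
    using assms by (simp add: distr_gaussian_entry std_normal_abs_moment)
  also have "\<dots> = (\<integral>\<^sup>+g. ennreal \<bar>g 0\<bar> \<partial>gaussian_vector n)"
    using assms by (intro nn_integral_distr measurable_gaussian_entry) auto
  also have "\<dots> \<le> gaussian_complexity n (bouquet e n)"
    unfolding gaussian_complexity_def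
  proof (intro nn_integral_mono)
    fix g :: "nat \<Rightarrow> real"
    have "ennreal \<bar>dot n (pole n) g\<bar> \<le> (SUP x\<in>bouquet e n. ennreal \<bar>dot n x g\<bar>)"
      by (intro SUP_upper) (simp add: bouquet_def)
    then show "ennreal \<bar>g 0\<bar> \<le> (SUP x\<in>bouquet e n. ennreal \<bar>dot n x g\<bar>)"
      using assms by (simp add: dot_pole)
  qed
  finally show ?thesis .
qed

text \<open>
  A linear bound replaces Jensen's inequality: \<open>u \<le> exp u\<close> bounds \<open>e \<bar>g\<^sub>j\<bar>\<close> by
  \<open>L\<close> plus a multiple of \<open>exp (\<bar>g\<^sub>j\<bar> / e)\<close>, and these exponentials may be summed over \<open>j\<close> before
  taking the mean. With \<open>n - 1 \<le> exp (B / e\<^sup>2)\<close>, the choice \<open>L = B + 1 / 2\<close> makes the mean of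
  the sum of these terms at most 2.
\<close>
lemma gaussian_complexity_bouquet_le:
  assumes n: "0 < n" and e: "0 < e" "e \<le> 1" and B: "0 \<le> B" "real n - 1 \<le> exp (B / e\<^sup>2)"
  shows "gaussian_complexity n (bouquet e n) \<le> ennreal (B + 4)"
proof -
  define L where "L = B + 1 / 2"
  define h where "h x = exp (x / e) + exp (- x / e)" for x
  define c where "c = exp (- L / e\<^sup>2)"
  have h0: "0 \<le> h x" for x by (simp add: h_def)
  have [measurable]: "h \<in> borel_measurable borel"
    unfolding h_def[abs_def] by measurable
  \<comment> \<open>The rate \<open>1/e\<close> gives moments \<open>exp (1 / (2 e\<^sup>2))\<close>, of the same form as the bound \<open>exp (B / e\<^sup>2)\<close> on their number.\<close>
  have lin: "e * \<bar>x\<bar> \<le> L + c * h x" for x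
  proof -
    have "(\<bar>x\<bar> - L / e) / e \<le> exp ((\<bar>x\<bar> - L / e) / e)"
      using exp_ge_add_one_self[of "(\<bar>x\<bar> - L / e) / e"] by linarith
    then have "e\<^sup>2 * ((\<bar>x\<bar> - L / e) / e) \<le> e\<^sup>2 * exp ((\<bar>x\<bar> - L / e) / e)"
      by (intro mult_left_mono) auto
    also have "\<dots> \<le> 1 * exp ((\<bar>x\<bar> - L / e) / e)"
      using e by (intro mult_right_mono) (auto intro: power_le_one)
    also have "e\<^sup>2 * ((\<bar>x\<bar> - L / e) / e) = e * \<bar>x\<bar> - L"
      using e by (simp add: field_simps power2_eq_square)
    also have "(\<bar>x\<bar> - L / e) / e = \<bar>x\<bar> / e + - L / e\<^sup>2"
      using e by (simp add: field_simps power2_eq_square)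
    also have "exp (\<bar>x\<bar> / e + - L / e\<^sup>2) = exp (\<bar>x\<bar> / e) * c"
      unfolding c_def by (rule exp_add)
    also have "exp (\<bar>x\<bar> / e) \<le> h x"
      by (auto simp: h_def abs_if)
    finally show ?thesis
      by (simp add: mult.commute c_def mult_left_mono)
  qed
  have pt: "(SUP x\<in>bouquet e n. ennreal \<bar>dot n x g\<bar>)
      \<le> ennreal \<bar>g 0\<bar> + (ennreal L + ennreal c * (\<Sum>j\<in>{1..<n}. ennreal (h (g j))))" for g
  proof (rule SUP_least)
    fix x assume x: "x \<in> bouquet e n"
    have "\<bar>dot n x g\<bar> \<le> \<bar>g 0\<bar> + (L + c * (\<Sum>j\<in>{1..<n}. h (g j)))"
    proof (cases "x = pole n")
      case True
      moreover have "0 \<le> c * (\<Sum>j\<in>{1..<n}. h (g j))"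
        by (intro mult_nonneg_nonneg sum_nonneg) (auto simp: c_def h0)
      ultimately show ?thesis
        using n B by (simp add: dot_pole L_def)
    next
      case False
      then obtain j where j: "x = spike e n j" "j \<in> {1..<n}"
        using x by (auto simp: bouquet_def)
      have "\<bar>dot n x g\<bar> \<le> \<bar>sqrt (1 - e\<^sup>2) * g 0\<bar> + \<bar>e * g j\<bar>"
        using j by (simp add: dot_spike abs_triangle_ineq)
      also have "\<bar>sqrt (1 - e\<^sup>2) * g 0\<bar> \<le> 1 * \<bar>g 0\<bar>"
        unfolding abs_mult using e by (intro mult_right_mono) (auto simp: power_le_one)
      also have "\<bar>e * g j\<bar> \<le> L + c * h (g j)"
        using lin[of "g j"] e by (simp add: abs_mult)
      also have "h (g j) \<le> (\<Sum>j\<in>{1..<n}. h (g j))"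
        using j h0 by (intro member_le_sum) auto
      finally show ?thesis
        by (simp add: c_def)
    qed
    then have "ennreal \<bar>dot n x g\<bar> \<le> ennreal (\<bar>g 0\<bar> + (L + c * (\<Sum>j\<in>{1..<n}. h (g j))))"
      by (rule ennreal_leI)
    also have "\<dots> = ennreal \<bar>g 0\<bar> + (ennreal L + ennreal c * (\<Sum>j\<in>{1..<n}. ennreal (h (g j))))"
      using B by (simp add: ennreal_plus ennreal_mult h0 sum_nonneg L_def c_def sum_ennreal)
    finally show "ennreal \<bar>dot n x g\<bar> \<le> \<dots>" .
  qed
  have entry: "(\<integral>\<^sup>+g. ennreal (f (g j)) \<partial>gaussian_vector n) = (\<integral>\<^sup>+x. ennreal (f x) \<partial>std_normal_distribution)"
    if "j < n" and [measurable]: "f \<in> borel_measurable borel" for j f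
    using that
    by (subst distr_gaussian_entry(2)[OF that(1), symmetric], subst nn_integral_distr)
      (auto intro: measurable_gaussian_entry)
  have sq: "(1 / e)\<^sup>2 / 2 = 1 / (2 * e\<^sup>2)" "(- 1 / e)\<^sup>2 / 2 = 1 / (2 * e\<^sup>2)"
    by (simp_all add: power_divide)
  have "(\<integral>\<^sup>+x. ennreal (h x) \<partial>std_normal_distribution)
      = (\<integral>\<^sup>+x. ennreal (exp (1 / e * x)) + ennreal (exp (- 1 / e * x)) \<partial>std_normal_distribution)"
    by (simp add: h_def)
  also have "\<dots> = ennreal (exp (1 / (2 * e\<^sup>2))) + ennreal (exp (1 / (2 * e\<^sup>2)))"
    unfolding sq(1)[symmetric] by (subst nn_integral_add) (simp_all only: std_normal_mgf sq, measurable)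
  also have "\<dots> = ennreal (2 * exp (1 / (2 * e\<^sup>2)))"
    unfolding mult_2 by (rule ennreal_plus[symmetric]) auto
  finally have "(\<integral>\<^sup>+x. ennreal (h x) \<partial>std_normal_distribution) = ennreal (2 * exp (1 / (2 * e\<^sup>2)))" .
  then have Eh: "(\<integral>\<^sup>+g. ennreal (h (g j)) \<partial>gaussian_vector n) = ennreal (2 * exp (1 / (2 * e\<^sup>2)))"
    if "j < n" for j
    using entry[OF that, of h] by simp
  interpret prob_space "gaussian_vector n" by (rule prob_space_gaussian)
  have [measurable]: "(\<lambda>g. g j) \<in> borel_measurable (gaussian_vector n)" if "j < n" for j
    using that by (rule measurable_gaussian_entry)
  have "gaussian_complexity n (bouquet e n)
      \<le> (\<integral>\<^sup>+g. ennreal \<bar>g 0\<bar> + (ennreal L + ennreal c * (\<Sum>j\<in>{1..<n}. ennreal (h (g j)))) \<partial>gaussian_vector n)"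
    unfolding gaussian_complexity_def by (intro nn_integral_mono pt)
  also have "\<dots> = (\<integral>\<^sup>+g. ennreal \<bar>g 0\<bar> \<partial>gaussian_vector n)
      + (ennreal L + ennreal c * (\<Sum>j\<in>{1..<n}. \<integral>\<^sup>+g. ennreal (h (g j)) \<partial>gaussian_vector n))"
  proof -
    have meas: "(\<lambda>g. ennreal (h (g j))) \<in> borel_measurable (gaussian_vector n)" if "j \<in> {1..<n}" for j
      using that by simp
    have "(\<integral>\<^sup>+g. (\<Sum>j\<in>{1..<n}. ennreal (h (g j))) \<partial>gaussian_vector n)
        = (\<Sum>j\<in>{1..<n}. \<integral>\<^sup>+g. ennreal (h (g j)) \<partial>gaussian_vector n)"
      by (rule nn_integral_sum) (rule meas)
    then show ?thesis
      using n borel_measurable_sum[OF meas] by (simp add: nn_integral_add nn_integral_cmult emeasure_space_1)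
  qed
  also have "\<dots> = ennreal (sqrt (2 / pi)) + (ennreal L + ennreal (c * ((real n - 1) * (2 * exp (1 / (2 * e\<^sup>2))))))"
  proof -
    have "(\<Sum>j\<in>{1..<n}. \<integral>\<^sup>+g. ennreal (h (g j)) \<partial>gaussian_vector n)
        = (\<Sum>j\<in>{1..<n}. ennreal (2 * exp (1 / (2 * e\<^sup>2))))"
      by (intro sum.cong refl Eh) auto
    also have "\<dots> = ennreal ((real n - 1) * (2 * exp (1 / (2 * e\<^sup>2))))"
      using n by (subst sum_ennreal) (auto simp: of_nat_diff)
    finally show ?thesis
      using n entry[OF n, of abs] by (simp only: c_def) (simp add: std_normal_abs_moment ennreal_mult)
  qed
  also have "\<dots> = ennreal (sqrt (2 / pi) + (L + c * ((real n - 1) * (2 * exp (1 / (2 * e\<^sup>2))))))"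
    using n B by (simp add: L_def c_def)
  also have "\<dots> \<le> ennreal (B + 4)"
  proof (rule ennreal_leI)
    have "c * ((real n - 1) * (2 * exp (1 / (2 * e\<^sup>2)))) \<le> c * (exp (B / e\<^sup>2) * (2 * exp (1 / (2 * e\<^sup>2))))"
      using B by (intro mult_left_mono mult_right_mono) (auto simp: c_def)
    also have "\<dots> = 2 * exp (- L / e\<^sup>2 + B / e\<^sup>2 + 1 / (2 * e\<^sup>2))"
      by (simp only: c_def exp_add mult_ac)
    also have "- L / e\<^sup>2 + B / e\<^sup>2 + 1 / (2 * e\<^sup>2) = 0"
      using e by (simp add: L_def field_simps)
    finally have "c * ((real n - 1) * (2 * exp (1 / (2 * e\<^sup>2)))) \<le> 2"
      by (simp only: exp_zero mult_1_right)
    then show "sqrt (2 / pi) + (L + c * ((real n - 1) * (2 * exp (1 / (2 * e\<^sup>2))))) \<le> B + 4"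
      using std_normal_abs_moment_bounds(2) unfolding L_def by linarith
  qed
  finally show ?thesis .
qed

section \<open>Tessellation probabilities of the bouquet\<close>

lemma uniform_tessellation_bouquet_prob:
  assumes n: "0 < n" and m: "0 < m" and \<delta>: "0 < \<delta>" "\<delta> \<le> 1"
  shows "1 - (real n - 1) * exp (- (\<delta> * m / 4))
    \<le> measure (gaussian_matrix m n) {G\<in>space (gaussian_matrix m n). uniform_tessellation m n \<delta> (bouquet (\<delta> / 16) n) G}"
proof -
  let ?M = "gaussian_matrix m n"
  interpret prob_space ?M by (rule prob_space_gaussian)
  define e where "e = \<delta> / 16"
  have e: "0 \<le> e" "e \<le> 1 / 2" "4 * e \<le> \<delta>"
    using \<delta> by (auto simp: e_def)
  define Q where "Q j i G \<longleftrightarrow> \<bar>G (i, 0)\<bar> \<le> 2 * e * \<bar>G (i, j)\<bar>" for j i :: nat and G :: "nat \<times> nat \<Rightarrow> real"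
  define Bad where "Bad j = {G\<in>space ?M. \<delta> * m / 2 \<le> card {i\<in>{..<m}. Q j i G}}" for j
  have Q_pred [measurable]: "Measurable.pred ?M (Q j i)" if "j < n" "i < m" for j i
  proof -
    have [measurable]: "(\<lambda>G. G (i, 0)) \<in> borel_measurable ?M" "(\<lambda>G. G (i, j)) \<in> borel_measurable ?M"
      using that n by (intro measurable_gaussian_entry; auto)+
    show ?thesis
      unfolding Q_def[abs_def] pred_def by (intro borel_measurable_le) measurable
  qed
  have bad: "prob (Bad j) \<le> exp (- (\<delta> * m / 4))" if j: "j \<in> {1..<n}" for j
  proof -
    have "indep_vars (\<lambda>_. count_space UNIV) (Q j) {..<m}"
      unfolding gaussian_matrix_def
    proof (rule indep_vars_PiM_blocks[where K="\<lambda>i. {(i, 0), (i, j)}"])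
      show "Q j i \<in> measurable (Pi\<^sub>M ({..<m} \<times> {..<n}) (\<lambda>p. std_normal_distribution)) (count_space UNIV)"
        if "i \<in> {..<m}" for i
        using Q_pred[of j i] that j
        by (simp add: gaussian_matrix_def)
    qed (use j in \<open>auto simp: disjoint_family_on_def Q_def\<close>)
    moreover have "prob {G\<in>space ?M. Q j i G} \<le> 2 * e" if "i \<in> {..<m}" for i
      unfolding Q_def using that j e by (intro gaussian_matrix_ratio_prob) auto
    ultimately have "prob (Bad j) \<le> exp (2 * (2 * e) * card {..<m} - \<delta> * m / 2)"
      unfolding Bad_def by (intro prob_card_ge) auto
    then show ?thesis
      by (simp add: e_def field_simps)
  qed
  have Bad_sets: "Bad j \<in> sets ?M" if "j \<in> {1..<n}" for j
  proof -
    have card_meas: "(\<lambda>G. real (card {i\<in>{..<m}. Q j i G})) \<in> borel_measurable ?M"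
      using that by (intro borel_measurable_card_Collect) auto
    show ?thesis
      unfolding Bad_def by (intro borel_measurable_le borel_measurable_const card_meas)
  qed
  have tess: "{G\<in>space ?M. uniform_tessellation m n \<delta> (bouquet e n) G} \<in> sets ?M"
    using pred_uniform_tessellation[OF finite_bouquet] by (simp add: pred_def)
  have "space ?M - (\<Union>j\<in>{1..<n}. Bad j) \<subseteq> {G\<in>space ?M. uniform_tessellation m n \<delta> (bouquet e n) G}"
  proof (intro subsetI CollectI conjI)
    fix G assume G: "G \<in> space ?M - (\<Union>j\<in>{1..<n}. Bad j)"
    then show "G \<in> space ?M" by simp
    show "uniform_tessellation m n \<delta> (bouquet e n) G"
    proof (rule uniform_tessellation_narrowI[OF m bouquet_geodesic_dist, OF n e(1,3) \<delta>(2)])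
      fix x assume "x \<in> bouquet e n"
      then consider "x = pole n" | j where "x = spike e n j" "j \<in> {1..<n}"
        by (auto simp: bouquet_def)
      then show "card (separated m n (pole n) x G) \<le> \<delta> * m / 2"
      proof cases
        case 1
        then show ?thesis
          using \<delta> by (simp add: separated_def)
      next
        case 2
        have "separated m n (pole n) x G \<subseteq> {i\<in>{..<m}. Q j i G}"
          using 2 separated_pole_spike_imp_ratio[of j n e _ m G] e by (auto simp: Q_def separated_def)
        then have "card (separated m n (pole n) x G) \<le> card {i\<in>{..<m}. Q j i G}"
          by (intro card_mono) auto
        moreover have "card {i\<in>{..<m}. Q j i G} < \<delta> * m / 2"
          using G 2 by (auto simp: Bad_def not_le)
        ultimately show ?thesis by linarith
      qed
    qed auto
  qed
  then have "prob (space ?M - (\<Union>j\<in>{1..<n}. Bad j)) \<le> prob {G\<in>space ?M. uniform_tessellation m n \<delta> (bouquet e n) G}"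
    by (intro finite_measure_mono tess)
  moreover have "prob (space ?M - (\<Union>j\<in>{1..<n}. Bad j)) = 1 - prob (\<Union>j\<in>{1..<n}. Bad j)"
    using Bad_sets by (intro prob_compl) auto
  moreover have "prob (\<Union>j\<in>{1..<n}. Bad j) \<le> (\<Sum>j\<in>{1..<n}. prob (Bad j))"
    using Bad_sets by (intro finite_measure_subadditive_finite) auto
  moreover have "(\<Sum>j\<in>{1..<n}. prob (Bad j)) \<le> (\<Sum>j\<in>{1..<n}. exp (- (\<delta> * m / 4)))"
    using bad by (intro sum_mono) auto
  moreover have "(\<Sum>j\<in>{1..<n}. exp (- (\<delta> * m / 4))) = (real n - 1) * exp (- (\<delta> * m / 4))"
    using n by (simp add: of_nat_diff)
  ultimately show ?thesis
    by (simp add: e_def)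
qed

text \<open>
  \<open>P\<close> prescribes the sign that the entry must have, row by row. By symmetry of the Gaussian it does not
  affect the bound.
\<close>
lemma gaussian_matrix_column_flip_prob:
  assumes j: "j < n" and I: "I \<subseteq> {..<m}" and t: "0 \<le> t"
  shows "exp (- (3 + t\<^sup>2)) ^ card I \<le> measure (gaussian_matrix m n)
    {G\<in>space (gaussian_matrix m n). \<forall>i\<in>I. if i \<in> P then G (i, j) \<le> - t else t \<le> G (i, j)}"
proof -
  let ?M = "gaussian_matrix m n"
  interpret prob_space ?M by (rule prob_space_gaussian)
  define Q where "Q i G \<longleftrightarrow> (if i \<in> P then G (i, j) \<le> - t else t \<le> G (i, j))" for i and G :: "nat \<times> nat \<Rightarrow> real"
  have "indep_vars (\<lambda>_. count_space UNIV) Q I"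
    unfolding gaussian_matrix_def
  proof (rule indep_vars_PiM_blocks[where K="\<lambda>i. {(i, j)}"])
    fix i assume "i \<in> I"
    then have "(\<lambda>G. G (i, j)) \<in> borel_measurable (Pi\<^sub>M ({..<m} \<times> {..<n}) (\<lambda>p. std_normal_distribution))"
      using measurable_gaussian_entry(1)[of "(i, j)" m n] I j by (auto simp: gaussian_matrix_def)
    then show "Q i \<in> measurable (Pi\<^sub>M ({..<m} \<times> {..<n}) (\<lambda>p. std_normal_distribution)) (count_space UNIV)"
      unfolding Q_def[abs_def] by measurable
  qed (use I j in \<open>auto simp: disjoint_family_on_def Q_def\<close>)
  moreover have "finite I"
    using I finite_subset by blast
  ultimately have "prob {G\<in>space ?M. \<forall>i\<in>I. Q i G} = (\<Prod>i\<in>I. prob {G\<in>space ?M. Q i G})"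
    by (intro prob_all_indep)
  moreover have "(\<Prod>i\<in>I. exp (- (3 + t\<^sup>2))) \<le> (\<Prod>i\<in>I. prob {G\<in>space ?M. Q i G})"
  proof (intro prod_mono conjI)
    fix i assume "i \<in> I"
    then have ij: "(i, j) \<in> {..<m} \<times> {..<n}"
      using I j by auto
    show "exp (- (3 + t\<^sup>2)) \<le> prob {G\<in>space ?M. Q i G}"
      using std_normal_prob_tail_ge[OF t] gaussian_matrix_entry_prob[OF ij, of "{t..}"]
        gaussian_matrix_entry_prob[OF ij, of "{..-t}"]
      by (cases "i \<in> P") (auto simp: Q_def)
  qed auto
  ultimately show ?thesis
    by (simp add: Q_def)
qed

text \<open>
  Conditioning on column 0 is done by a finite partition: a pattern \<open>(T, P)\<close> records the rows \<open>T\<close>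
  whose entry in column 0 is at most \<open>\<tau>\<close> in absolute value, and the rows \<open>P\<close> where it is
  nonnegative. If \<open>T\<close> has at least \<open>r\<close> rows, fix \<open>r\<close> of them. A spike whose entries are opposite and
  large in these rows is separated from the pole by \<open>r > 2\<delta>m\<close> rows, which exceeds what the tessellation
  allows. Given the pattern, the spikes fail independently, since they use different columns, and each
  fails with probability at most \<open>1 - q\<^sup>r \<le> exp (- q\<^sup>r)\<close>. The bound for a failure of all of them is the
  same for every pattern, so it survives summation over the disjoint patterns.
\<close>
lemma not_uniform_tessellation_bouquet_prob:
  fixes \<delta> e \<tau> :: real
  assumes n: "0 < n" and m: "0 < m" and e: "0 < e" "4 * e \<le> \<delta>" "\<delta> \<le> 1" and \<tau>: "0 < \<tau>"
    and r: "2 * \<delta> * m < real r"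
  shows "measure (gaussian_matrix m n) {G\<in>space (gaussian_matrix m n). r \<le> card {i\<in>{..<m}. \<bar>G (i, 0)\<bar> \<le> \<tau>}}
      - exp (- ((real n - 1) * exp (- (3 + (\<tau> / e)\<^sup>2)) ^ r))
    \<le> measure (gaussian_matrix m n) {G\<in>space (gaussian_matrix m n). \<not> uniform_tessellation m n \<delta> (bouquet e n) G}"
proof -
  let ?M = "gaussian_matrix m n"
  interpret prob_space ?M by (rule prob_space_gaussian)
  let ?tess = "{G\<in>space ?M. \<not> uniform_tessellation m n \<delta> (bouquet e n) G}"
  let ?near = "\<lambda>G. {i\<in>{..<m}. \<bar>G (i, 0)\<bar> \<le> \<tau>}"
  define t where "t = \<tau> / e"
  have t: "0 \<le> t" using e \<tau> by (simp add: t_def)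
  define q where "q = exp (- (3 + t\<^sup>2))"
  have [measurable]: "(\<lambda>G. G (i, j)) \<in> borel_measurable ?M" if "i \<in> {..<m}" "j \<in> {..<n}" for i j
    using that by (intro measurable_gaussian_entry) auto
  have "\<exists>I\<subseteq>T. card I = r" if "r \<le> card T" for T :: "nat set"
    using obtain_subset_with_card_n[OF that] by metis
  then obtain sub where sub: "\<And>T :: nat set. r \<le> card T \<Longrightarrow> sub T \<subseteq> T \<and> card (sub T) = r"
    by metis
  define pat where "pat = (\<lambda>(T, P). {G\<in>space ?M. \<forall>i\<in>{..<m}. (\<bar>G (i, 0)\<bar> \<le> \<tau> \<longleftrightarrow> i \<in> T) \<and> (0 \<le> G (i, 0) \<longleftrightarrow> i \<in> P)})"
  define flip where "flip T P j G \<longleftrightarrow> (\<forall>i\<in>sub T. if i \<in> P then G (i, j) \<le> - t else t \<le> G (i, j))"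
    for T P j and G :: "nat \<times> nat \<Rightarrow> real"
  define Bad where "Bad = (\<lambda>(T, P). {G\<in>pat (T, P). \<forall>j\<in>{1..<n}. \<not> flip T P j G})"
  define Pats where "Pats = {T\<in>Pow {..<m}. r \<le> card T} \<times> Pow {..<m}"
  have fin: "finite Pats" by (simp add: Pats_def)
  have pat_sets: "pat x \<in> sets ?M" for x
    unfolding pat_def using n by (cases x) simp
  have flip_pred: "Measurable.pred ?M (flip T P j)" if "(T, P) \<in> Pats" "j < n" for T P j
  proof -
    have *: "sub T \<subseteq> {..<m}"
      using sub[of T] that by (auto simp: Pats_def)
    then have [measurable]: "finite (sub T)"
      using finite_subset by blast
    have [measurable]: "(\<lambda>G. G (i, j)) \<in> borel_measurable ?M" if "i \<in> sub T" for i
      using that * \<open>j < n\<close> by (intro measurable_gaussian_entry) auto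
    show ?thesis
      unfolding flip_def[abs_def] by (intro pred_intros_finite) measurable
  qed
  have Bad_sets: "Bad x \<in> sets ?M" if "x \<in> Pats" for x
  proof -
    obtain T P where x: "x = (T, P)" by (cases x)
    have "Bad x = pat x \<inter> {G\<in>space ?M. \<forall>j\<in>{1..<n}. \<not> flip T P j G}"
      by (auto simp: Bad_def pat_def x)
    moreover have "{G\<in>space ?M. \<forall>j\<in>{1..<n}. \<not> flip T P j G} \<in> sets ?M"
      unfolding pred_def[symmetric] using flip_pred[of T P] that x by (intro pred_intros_finite pred_intros_logic) auto
    ultimately show ?thesis
      using pat_sets by auto
  qed
  have bad: "prob (Bad x) \<le> prob (pat x) * exp (- ((real n - 1) * q ^ r))" if x: "x \<in> Pats" for x
  proof -
    obtain T P where xTP: "x = (T, P)" by (cases x)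
    have subT: "sub T \<subseteq> {..<m}" "card (sub T) = r"
      using sub[of T] x xTP by (auto simp: Pats_def)
    define Q where "Q l G \<longleftrightarrow> (if l = 0 then \<forall>i\<in>{..<m}. (\<bar>G (i, 0)\<bar> \<le> \<tau> \<longleftrightarrow> i \<in> T) \<and> (0 \<le> G (i, 0) \<longleftrightarrow> i \<in> P)
        else \<not> flip T P l G)" for l G
    have Q_pred: "Measurable.pred ?M (Q l)" if "l < n" for l
      using flip_pred[of T P l] that x xTP pat_sets[of x]
      by (cases "l = 0") (auto simp: Q_def[abs_def] pat_def pred_def)
    \<comment> \<open>Column 0 carries the pattern and column \<open>l > 0\<close> the failure of spike \<open>l\<close>.\<close>
    have "indep_vars (\<lambda>_. count_space UNIV) Q {..<n}"
      unfolding gaussian_matrix_def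
    proof (rule indep_vars_PiM_blocks[where K="\<lambda>l. {..<m} \<times> {l}"])
      show "Q l \<in> measurable (Pi\<^sub>M ({..<m} \<times> {..<n}) (\<lambda>p. std_normal_distribution)) (count_space UNIV)"
        if "l \<in> {..<n}" for l
        using Q_pred[of l] that by (simp add: gaussian_matrix_def)
      show "Q l G = Q l G'" if "\<And>p. p \<in> {..<m} \<times> {l} \<Longrightarrow> G p = G' p" for l G G'
      proof -
        have "G (i, l) = G' (i, l)" if "i < m" for i
          using that \<open>\<And>p. p \<in> {..<m} \<times> {l} \<Longrightarrow> G p = G' p\<close> by auto
        moreover from this have "flip T P l G = flip T P l G'"
          unfolding flip_def using subT(1) by (intro ball_cong) auto
        ultimately show ?thesis
          by (auto simp: Q_def)
      qed
    qed (auto simp: disjoint_family_on_def)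
    then have "prob {G\<in>space ?M. \<forall>l\<in>{..<n}. Q l G} = (\<Prod>l<n. prob {G\<in>space ?M. Q l G})"
      by (intro prob_all_indep) auto
    also have "{..<n} = insert 0 {1..<n}"
      using n by auto
    also have "{G\<in>space ?M. \<forall>l\<in>insert 0 {1..<n}. Q l G} = Bad x"
      by (auto simp: xTP Bad_def pat_def Q_def)
    also have "(\<Prod>l\<in>insert 0 {1..<n}. prob {G\<in>space ?M. Q l G}) = prob (pat x) * (\<Prod>l\<in>{1..<n}. prob {G\<in>space ?M. Q l G})"
      by (simp add: xTP pat_def Q_def)
    also have "(\<Prod>l\<in>{1..<n}. prob {G\<in>space ?M. Q l G}) \<le> (\<Prod>l\<in>{1..<n}. exp (- (q ^ r)))"
    proof (intro prod_mono conjI)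
      fix l assume l: "l \<in> {1..<n}"
      have "{G\<in>space ?M. flip T P l G} \<in> sets ?M"
        using flip_pred[of T P l] x xTP l by (auto simp: pred_def)
      then have "prob {G\<in>space ?M. \<not> flip T P l G} = 1 - prob {G\<in>space ?M. flip T P l G}"
        by (intro prob_neg)
      moreover have "q ^ r \<le> prob {G\<in>space ?M. flip T P l G}"
        unfolding flip_def q_def subT(2)[symmetric] using l by (intro gaussian_matrix_column_flip_prob subT t) auto
      moreover have "1 - q ^ r \<le> exp (- (q ^ r))"
        using exp_ge_add_one_self[of "- (q ^ r)"] by simp
      ultimately show "prob {G\<in>space ?M. Q l G} \<le> exp (- (q ^ r))"
        using l by (simp add: Q_def)
    qed auto
    also have "(\<Prod>l\<in>{1..<n}. exp (- (q ^ r))) = exp (- ((real n - 1) * q ^ r))"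
      using n by (simp add: exp_of_nat_mult[symmetric] of_nat_diff)
    finally show ?thesis
      by (simp add: mult_left_mono)
  qed
  have UN_sets: "(\<Union>x\<in>Pats. Bad x) \<in> sets ?M"
    using fin Bad_sets by (rule sets.finite_UN)
  have tess_sets: "?tess \<in> sets ?M"
    using pred_uniform_tessellation[OF finite_bouquet, of m n \<delta> e n] by (simp add: pred_def sets.sets_Collect_neg)
  have sub1: "{G\<in>space ?M. r \<le> card (?near G)} \<subseteq> ?tess \<union> (\<Union>x\<in>Pats. Bad x)"
  proof
    fix G assume G: "G \<in> {G\<in>space ?M. r \<le> card (?near G)}"
    define T where "T = ?near G"
    define P where "P = {i\<in>{..<m}. 0 \<le> G (i, 0)}"
    have TP: "(T, P) \<in> Pats" "G \<in> pat (T, P)"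
      using G by (auto simp: Pats_def T_def P_def pat_def)
    have T: "sub T \<subseteq> T" "card (sub T) = r"
      using sub[of T] G by (auto simp: T_def)
    show "G \<in> ?tess \<union> (\<Union>x\<in>Pats. Bad x)"
    proof (cases "\<exists>j\<in>{1..<n}. flip T P j G")
      case True
      then obtain j where j: "0 < j" "j < n" and fl: "flip T P j G"
        by (auto simp: Suc_le_eq)
      have "sub T \<subseteq> separated m n (pole n) (spike e n j) G"
      proof
        fix i assume i: "i \<in> sub T"
        then have "i \<in> T" using T by auto
        then show "i \<in> separated m n (pole n) (spike e n j) G"
          using i fl j e \<tau>
          by (intro separated_pole_spikeI[where \<tau>=\<tau>]) (auto simp: flip_def T_def P_def t_def split: if_splits)
      qed
      then have "r \<le> card (separated m n (pole n) (spike e n j) G)"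
        using card_mono[of "separated m n (pole n) (spike e n j) G" "sub T"] T by simp
      then have "\<not> uniform_tessellation m n \<delta> (bouquet e n) G"
        using j n m e r bouquet_geodesic_dist[of n e \<delta> "pole n" "spike e n j"]
        by (intro not_uniform_tessellationI[of "pole n" _ "spike e n j"]) (auto simp: bouquet_def)
      then show ?thesis using G by simp
    next
      case False
      then have "G \<in> Bad (T, P)"
        using TP by (auto simp: Bad_def)
      then show ?thesis using TP by blast
    qed
  qed
  have "prob (\<Union>x\<in>Pats. Bad x) \<le> (\<Sum>x\<in>Pats. prob (Bad x))"
    using Bad_sets fin by (intro finite_measure_subadditive_finite) auto
  also have "\<dots> \<le> (\<Sum>x\<in>Pats. prob (pat x) * exp (- ((real n - 1) * q ^ r)))"
    by (intro sum_mono bad)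
  also have "\<dots> = prob (\<Union>x\<in>Pats. pat x) * exp (- ((real n - 1) * q ^ r))"
  proof -
    have "disjoint_family_on pat Pats"
    proof -
      have "T = T' \<and> P = P'" if "(T, P) \<in> Pats" "(T', P') \<in> Pats" "G \<in> pat (T, P)" "G \<in> pat (T', P')" for G T P T' P'
      proof -
        have "T \<subseteq> {..<m}" "T' \<subseteq> {..<m}" "P \<subseteq> {..<m}" "P' \<subseteq> {..<m}"
          using that(1,2) by (auto simp: Pats_def)
        moreover have "i \<in> T \<longleftrightarrow> i \<in> T'" "i \<in> P \<longleftrightarrow> i \<in> P'" if "i < m" for i
          using \<open>G \<in> pat (T, P)\<close> \<open>G \<in> pat (T', P')\<close> that by (auto simp: pat_def)
        ultimately show ?thesis by blast
      qed
      then show ?thesis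
        unfolding disjoint_family_on_def by fast
    qed
    then have "prob (\<Union>x\<in>Pats. pat x) = (\<Sum>x\<in>Pats. prob (pat x))"
      using fin pat_sets by (intro finite_measure_finite_Union) auto
    then show ?thesis
      by (simp add: sum_distrib_right)
  qed
  also have "\<dots> \<le> 1 * exp (- ((real n - 1) * q ^ r))"
    by (intro mult_right_mono) auto
  finally have "prob (\<Union>x\<in>Pats. Bad x) \<le> exp (- ((real n - 1) * q ^ r))"
    by simp
  moreover have "prob {G\<in>space ?M. r \<le> card (?near G)} \<le> prob (?tess \<union> (\<Union>x\<in>Pats. Bad x))"
    by (intro finite_measure_mono sub1 sets.Un tess_sets UN_sets)
  moreover have "prob (?tess \<union> (\<Union>x\<in>Pats. Bad x)) \<le> prob ?tess + prob (\<Union>x\<in>Pats. Bad x)"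
    by (rule measure_Un_le[OF tess_sets UN_sets])
  ultimately show ?thesis
    unfolding q_def t_def by linarith
qed

section \<open>Transition at the inverse cube of the accuracy\<close>

lemma exp_minus_of_nat_le: "exp (- real k) \<le> 1 / 2 ^ k"
proof -
  have "(2::real) ^ k \<le> exp 1 ^ k"
    using exp_ge_add_one_self[of 1] by (intro power_mono) auto
  then show ?thesis
    by (simp add: exp_minus exp_of_nat_mult[symmetric] field_simps)
qed

text \<open>
  The expected number of entries of size at most \<open>120 \<delta>\<close> in a column is at least \<open>40 \<delta> m\<close>, far above
  the required \<open>2 \<delta> m\<close>. The constant 120 only serves to make the Chernoff exponent at most \<open>- 18 \<delta> m \<le> - 9\<close>.
\<close>
lemma many_gaussian_entries_near_0:
  fixes \<delta> :: real
  assumes n: "0 < n" and \<delta>: "0 < \<delta>" "120 * \<delta> \<le> 1" and m: "1 \<le> 2 * \<delta> * m" and r: "real r \<le> 2 * \<delta> * m + 1"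
  shows "511 / 512 \<le> measure (gaussian_matrix m n)
    {G\<in>space (gaussian_matrix m n). r \<le> card {i\<in>{..<m}. \<bar>G (i, 0)\<bar> \<le> 120 * \<delta>}}"
proof -
  let ?M = "gaussian_matrix m n"
  interpret prob_space ?M by (rule prob_space_gaussian)
  define Q where "Q i G \<longleftrightarrow> \<bar>G (i, 0)\<bar> \<le> 120 * \<delta>" for i :: nat and G :: "nat \<times> nat \<Rightarrow> real"
  have Q_pred: "Measurable.pred ?M (Q i)" if "i \<in> {..<m}" for i
  proof -
    have [measurable]: "(\<lambda>G. G (i, 0)) \<in> borel_measurable ?M"
      using that n by (intro measurable_gaussian_entry) auto
    show ?thesis
      unfolding Q_def[abs_def] by measurable
  qed
  have card_meas: "(\<lambda>G. real (card {i\<in>{..<m}. Q i G})) \<in> borel_measurable ?M"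
    by (intro borel_measurable_card_Collect Q_pred) auto
  have few_sets: "{G\<in>space ?M. real (card {i\<in>{..<m}. Q i G}) \<le> 2 * \<delta> * m} \<in> sets ?M"
    by (intro borel_measurable_le borel_measurable_const card_meas)
  have "indep_vars (\<lambda>_. count_space UNIV) Q {..<m}"
    unfolding gaussian_matrix_def
  proof (rule indep_vars_PiM_blocks[where K="\<lambda>i. {(i, 0)}"])
    show "Q i \<in> measurable (Pi\<^sub>M ({..<m} \<times> {..<n}) (\<lambda>p. std_normal_distribution)) (count_space UNIV)"
      if "i \<in> {..<m}" for i
      using Q_pred[OF that] by (simp add: gaussian_matrix_def)
  qed (use n in \<open>auto simp: disjoint_family_on_def Q_def\<close>)
  moreover have "40 * \<delta> \<le> prob {G\<in>space ?M. Q i G}" if "i \<in> {..<m}" for i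
  proof -
    have "prob {G\<in>space ?M. Q i G} = measure std_normal_distribution {x. \<bar>x\<bar> \<le> 120 * \<delta>}"
      using gaussian_matrix_entry_prob[of "(i, 0)" m n "{x. \<bar>x\<bar> \<le> 120 * \<delta>}"] that n by (simp add: Q_def)
    then show ?thesis
      using std_normal_prob_abs_ge[of "120 * \<delta>"] \<delta> by simp
  qed
  ultimately have "prob {G\<in>space ?M. real (card {i\<in>{..<m}. Q i G}) \<le> 2 * \<delta> * m} \<le> exp (2 * \<delta> * m - 40 * \<delta> * card {..<m} / 2)"
    by (intro prob_card_le) auto
  also have "\<dots> \<le> exp (- real 9)"
    using m by simp
  also have "\<dots> \<le> 1 / 512"
    using exp_minus_of_nat_le[of 9] by simp
  finally have "511 / 512 \<le> 1 - prob {G\<in>space ?M. real (card {i\<in>{..<m}. Q i G}) \<le> 2 * \<delta> * m}"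
    by simp
  also have "\<dots> = prob {G\<in>space ?M. \<not> real (card {i\<in>{..<m}. Q i G}) \<le> 2 * \<delta> * m}"
    by (rule prob_neg[OF few_sets, symmetric])
  also have "\<dots> \<le> prob {G\<in>space ?M. r \<le> card {i\<in>{..<m}. Q i G}}"
  proof (rule finite_measure_mono)
    have "{G\<in>space ?M. real r \<le> real (card {i\<in>{..<m}. Q i G})} \<in> sets ?M"
      by (intro borel_measurable_le borel_measurable_const card_meas)
    then show "{G\<in>space ?M. r \<le> card {i\<in>{..<m}. Q i G}} \<in> sets ?M"
      by (simp only: of_nat_le_iff)
    show "{G\<in>space ?M. \<not> real (card {i\<in>{..<m}. Q i G}) \<le> 2 * \<delta> * m} \<subseteq> {G\<in>space ?M. r \<le> card {i\<in>{..<m}. Q i G}}"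
    proof (clarsimp simp: not_le)
      fix G assume "2 * \<delta> * m < real (card {i. i < m \<and> Q i G})"
      then have "real r < real (card {i. i < m \<and> Q i G}) + 1"
        using r by linarith
      then show "r \<le> card {i. i < m \<and> Q i G}"
        by linarith
    qed
  qed
  finally show ?thesis
    by (simp add: Q_def)
qed

text \<open>Chebyshev's inequality for the first row alone.\<close>
lemma one_gaussian_entry_bounded:
  assumes n: "0 < n" and m: "0 < m"
  shows "399 / 400 \<le> measure (gaussian_matrix m n)
    {G\<in>space (gaussian_matrix m n). 1 \<le> card {i\<in>{..<m}. \<bar>G (i, 0)\<bar> \<le> 20}}"
proof -
  let ?M = "gaussian_matrix m n"
  interpret prob_space ?M by (rule prob_space_gaussian)
  have [measurable]: "(\<lambda>G. G (i, 0)) \<in> borel_measurable ?M" if "i \<in> {..<m}" for i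
    using that n by (intro measurable_gaussian_entry) auto
  have card_meas: "(\<lambda>G. real (card {i\<in>{..<m}. \<bar>G (i, 0)\<bar> \<le> 20})) \<in> borel_measurable ?M"
    by (rule borel_measurable_card_Collect[OF finite_lessThan]) measurable
  have "{G\<in>space ?M. 1 \<le> real (card {i\<in>{..<m}. \<bar>G (i, 0)\<bar> \<le> 20})} \<in> sets ?M"
    by (intro borel_measurable_le borel_measurable_const card_meas)
  then have sets: "{G\<in>space ?M. 1 \<le> card {i\<in>{..<m}. \<bar>G (i, 0)\<bar> \<le> 20}} \<in> sets ?M"
    by (simp only: real_of_nat_ge_one_iff)
  have "prob {G\<in>space ?M. 20 < \<bar>G (0, 0)\<bar>} \<le> 1 / 20\<^sup>2"
    using std_normal_prob_abs_gt[of 20] gaussian_matrix_entry_prob[of "(0, 0)" m n "{x. 20 < \<bar>x\<bar>}"] n m by simp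
  moreover have "{G\<in>space ?M. \<bar>G (0, 0)\<bar> \<le> 20} \<in> sets ?M"
    using m by simp
  then have "prob {G\<in>space ?M. \<not> \<bar>G (0, 0)\<bar> \<le> 20} = 1 - prob {G\<in>space ?M. \<bar>G (0, 0)\<bar> \<le> 20}"
    by (rule prob_neg)
  moreover have "prob {G\<in>space ?M. \<bar>G (0, 0)\<bar> \<le> 20} \<le> prob {G\<in>space ?M. 1 \<le> card {i\<in>{..<m}. \<bar>G (i, 0)\<bar> \<le> 20}}"
  proof (rule finite_measure_mono[OF _ sets], intro subsetI CollectI conjI)
    fix G assume "G \<in> {G\<in>space ?M. \<bar>G (0, 0)\<bar> \<le> 20}"
    then have "card {0::nat} \<le> card {i\<in>{..<m}. \<bar>G (i, 0)\<bar> \<le> 20}"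
      using m by (intro card_mono) auto
    then show "1 \<le> card {i\<in>{..<m}. \<bar>G (i, 0)\<bar> \<le> 20}"
      by simp
  qed auto
  ultimately show ?thesis
    by (simp add: not_le)
qed

text \<open>
  If \<open>2\<delta>m < 1\<close>, one separating row is enough, so the first row is used with \<open>\<tau> = 20\<close>. Otherwise \<open>r \<le> 4\<delta>m\<close>
  rows are needed and \<open>\<tau> = 120 \<delta>\<close>. Then \<open>\<tau>/e\<close> is constant and \<open>r \<le> 4 / \<delta>\<^sup>2\<close> by the bound on \<open>m\<close>. In
  both cases the cost \<open>r (3 + (\<tau>/e)\<^sup>2)\<close> stays below \<open>15000000 / \<delta>\<^sup>2\<close>, which the number of spikes beats.
\<close>
lemma bouquet_tessellation_fails:
  fixes \<delta> :: real
  assumes \<delta>: "0 < \<delta>" "\<delta> < 1 / 200" and n: "0 < n" "exp (16000000 / \<delta>\<^sup>2) \<le> real n - 1"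
    and m: "0 < m" "m * \<delta> ^ 3 \<le> 1"
  shows "0.99 \<le> measure (gaussian_matrix m n)
    {G\<in>space (gaussian_matrix m n). \<not> uniform_tessellation m n \<delta> (bouquet (\<delta> / 16) n) G}"
proof -
  let ?M = "gaussian_matrix m n"
  have d2: "0 < \<delta>\<^sup>2" "\<delta>\<^sup>2 \<le> 1"
    using \<delta> by (auto simp: power_le_one)
  \<comment> \<open>At this cost, the expected number of spikes separated in all \<open>r\<close> rows is at least 8.\<close>
  have miss: "exp (- ((real n - 1) * exp (- (3 + (\<tau> / (\<delta> / 16))\<^sup>2)) ^ r)) \<le> 1 / 256"
    if "r * (3 + (\<tau> / (\<delta> / 16))\<^sup>2) \<le> 15000000 / \<delta>\<^sup>2" for \<tau> and r :: nat
  proof -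
    have "1000000 / 1 \<le> 1000000 / \<delta>\<^sup>2"
      using d2 by (intro divide_left_mono) auto
    then have "8 \<le> 1 + (16000000 / \<delta>\<^sup>2 - 15000000 / \<delta>\<^sup>2)"
      by simp
    also have "\<dots> \<le> exp (16000000 / \<delta>\<^sup>2 - 15000000 / \<delta>\<^sup>2)"
      by (rule exp_ge_add_one_self)
    also have "\<dots> = exp (16000000 / \<delta>\<^sup>2) * exp (- (15000000 / \<delta>\<^sup>2))"
      by (simp only: exp_add[symmetric] diff_conv_add_uminus)
    also have "\<dots> \<le> (real n - 1) * exp (- (r * (3 + (\<tau> / (\<delta> / 16))\<^sup>2)))"
      using that n by (intro mult_mono) auto
    also have "exp (- (r * (3 + (\<tau> / (\<delta> / 16))\<^sup>2))) = exp (- (3 + (\<tau> / (\<delta> / 16))\<^sup>2)) ^ r"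
      by (simp only: exp_of_nat_mult[symmetric] mult_minus_right)
    finally have "exp (- ((real n - 1) * exp (- (3 + (\<tau> / (\<delta> / 16))\<^sup>2)) ^ r)) \<le> exp (- real 8)"
      by simp
    also have "\<dots> \<le> 1 / 256"
      using exp_minus_of_nat_le[of 8] by simp
    finally show ?thesis .
  qed
  show ?thesis
  proof (cases "2 * \<delta> * m < 1")
    case True
    have "real 1 * (3 + (20 / (\<delta> / 16))\<^sup>2) \<le> 15000000 / \<delta>\<^sup>2"
      using d2 by (simp add: field_simps power2_eq_square)
    from miss[OF this] show ?thesis
      using not_uniform_tessellation_bouquet_prob[of n m "\<delta> / 16" \<delta> 20 1] one_gaussian_entry_bounded[of n m]
        n m \<delta> True by simp
  next
    case False
    define r where "r = nat \<lfloor>2 * \<delta> * m\<rfloor> + 1"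
    have r: "2 * \<delta> * m < real r" "real r \<le> 2 * \<delta> * m + 1"
      using False by (auto simp: r_def) linarith+
    have "real r \<le> 4 * (\<delta> * m)"
      using r False by simp
    also have "\<delta> * m \<le> 1 / \<delta>\<^sup>2"
      using m d2 by (simp add: field_simps power2_eq_square power3_eq_cube)
    finally have "real r * (3 + (120 * \<delta> / (\<delta> / 16))\<^sup>2) \<le> (4 * (1 / \<delta>\<^sup>2)) * (3 + (120 * \<delta> / (\<delta> / 16))\<^sup>2)"
      by (intro mult_right_mono) auto
    also have "\<dots> \<le> 15000000 / \<delta>\<^sup>2"
      using \<delta> d2 by (simp add: divide_right_mono)
    finally have "real r * (3 + (120 * \<delta> / (\<delta> / 16))\<^sup>2) \<le> 15000000 / \<delta>\<^sup>2" .
    from miss[OF this] show ?thesis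
      using not_uniform_tessellation_bouquet_prob[of n m "\<delta> / 16" \<delta> "120 * \<delta>" r]
        many_gaussian_entries_near_0[of n \<delta> m r] n m \<delta> r False by simp
  qed
qed

text \<open>
  The assumption on \<open>m\<close> says that the Chernoff exponent \<open>\<delta>m/4\<close> exceeds the entropy \<open>K / \<delta>\<^sup>2\<close> of the union
  bound by at least 7.
\<close>
lemma bouquet_tessellation_succeeds:
  fixes \<delta> K :: real
  assumes \<delta>: "0 < \<delta>" "\<delta> \<le> 1" and n: "0 < n" "real n - 1 \<le> exp (K / \<delta>\<^sup>2)"
    and m: "0 < m" "4 * (K + 7) \<le> m * \<delta> ^ 3"
  shows "0.99 \<le> measure (gaussian_matrix m n)
    {G\<in>space (gaussian_matrix m n). uniform_tessellation m n \<delta> (bouquet (\<delta> / 16) n) G}"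
proof -
  have d2: "0 < \<delta>\<^sup>2" "\<delta>\<^sup>2 \<le> 1"
    using \<delta> by (auto simp: power_le_one)
  have "(K + 7) / \<delta>\<^sup>2 \<le> \<delta> * m / 4"
    using m d2 by (simp add: field_simps power2_eq_square power3_eq_cube)
  moreover have "7 \<le> 7 / \<delta>\<^sup>2"
    using d2 by (simp add: field_simps)
  ultimately have "K / \<delta>\<^sup>2 - \<delta> * m / 4 \<le> - real 7"
    unfolding add_divide_distrib by linarith
  then have "exp (K / \<delta>\<^sup>2 - \<delta> * m / 4) \<le> exp (- real 7)"
    by (simp only: exp_le_cancel_iff)
  also have "\<dots> \<le> 1 / 128"
    using exp_minus_of_nat_le[of 7] by simp
  finally have "exp (K / \<delta>\<^sup>2) * exp (- (\<delta> * m / 4)) \<le> 1 / 128"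
    by (simp only: diff_conv_add_uminus exp_add)
  moreover have "(real n - 1) * exp (- (\<delta> * m / 4)) \<le> exp (K / \<delta>\<^sup>2) * exp (- (\<delta> * m / 4))"
    using n by (intro mult_right_mono) auto
  ultimately have "(real n - 1) * exp (- (\<delta> * m / 4)) \<le> 1 / 128"
    by linarith
  then show ?thesis
    using uniform_tessellation_bouquet_prob[OF n(1) m(1) \<delta>] by simp
qed

theorem theorem1p4:
  "\<exists>c c1 c2 :: real. c > 0 \<and> c1 > c2 \<and> c2 > 0 \<and>
    (\<forall>\<delta>::real. 0 < \<delta> \<and> \<delta> < c \<longrightarrow>
      (\<exists>(n::nat) S. S \<noteq> {} \<and> S \<subseteq> unit_sphere n \<and>
        (\<forall>m::nat. m > 0 \<longrightarrow>
          (of_nat m \<ge> ennreal (c1 / \<delta> ^ 3) * (gaussian_complexity n S)\<^sup>2 \<longrightarrow>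
            \<P>(G in gaussian_matrix m n. uniform_tessellation m n \<delta> S G) \<ge> 0.99) \<and>
          (of_nat m \<le> ennreal (c2 / \<delta> ^ 3) * (gaussian_complexity n S)\<^sup>2 \<longrightarrow>
            \<P>(G in gaussian_matrix m n. \<not> uniform_tessellation m n \<delta> S G) \<ge> 0.99))))"
proof -
  define K :: real where "K = 16000001"
  \<comment> \<open>\<open>exp (K / \<delta>\<^sup>2)\<close> bounds the number of spikes; with \<open>e = \<delta>/16\<close> this is \<open>exp ((K / 256) / e\<^sup>2)\<close>.\<close>
  define b where "b = K / 256 + 4"
  \<comment> \<open>The complexity lies in \<open>[1/2, b]\<close>, which fixes how \<open>c1\<close> and \<open>c2\<close> translate into bounds on \<open>m \<delta>\<^sup>3\<close>.\<close>
  define c1 where "c1 = 16 * (K + 7)"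
  define c2 where "c2 = 1 / b\<^sup>2"
  have b: "1 \<le> b"
    by (simp add: b_def K_def)
  have c2: "0 < c2" "c2 \<le> 1"
    using b by (auto simp: c2_def field_simps)
  have "c2 < c1"
    using c2 by (simp add: c1_def K_def)
  moreover have "\<exists>(n::nat) S. S \<noteq> {} \<and> S \<subseteq> unit_sphere n \<and>
        (\<forall>m::nat. m > 0 \<longrightarrow>
          (of_nat m \<ge> ennreal (c1 / \<delta> ^ 3) * (gaussian_complexity n S)\<^sup>2 \<longrightarrow>
            \<P>(G in gaussian_matrix m n. uniform_tessellation m n \<delta> S G) \<ge> 0.99) \<and>
          (of_nat m \<le> ennreal (c2 / \<delta> ^ 3) * (gaussian_complexity n S)\<^sup>2 \<longrightarrow>
            \<P>(G in gaussian_matrix m n. \<not> uniform_tessellation m n \<delta> S G) \<ge> 0.99))"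
    if \<delta>: "0 < \<delta>" "\<delta> < 1 / 200" for \<delta> :: real
  proof -
    have d2: "0 < \<delta>\<^sup>2" "\<delta>\<^sup>2 \<le> 1"
      using \<delta> by (auto simp: power_le_one)
    define n where "n = nat \<lceil>exp (16000000 / \<delta>\<^sup>2)\<rceil> + 1"
    have n: "0 < n" "exp (16000000 / \<delta>\<^sup>2) \<le> real n - 1" "real n - 1 \<le> exp (16000000 / \<delta>\<^sup>2) + 1"
      by (auto simp: n_def)
    have "exp (16000000 / \<delta>\<^sup>2) + 1 \<le> exp (16000000 / \<delta>\<^sup>2) * 2"
      by simp
    also have "\<dots> \<le> exp (16000000 / \<delta>\<^sup>2) * exp (1 / \<delta>\<^sup>2)"
    proof (rule mult_left_mono)
      have "1 \<le> 1 / \<delta>\<^sup>2"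
        using d2 by (simp add: field_simps)
      then show "2 \<le> exp (1 / \<delta>\<^sup>2)"
        using exp_ge_add_one_self[of "1 / \<delta>\<^sup>2"] by linarith
    qed simp
    also have "\<dots> = exp (K / \<delta>\<^sup>2)"
      by (simp add: exp_add[symmetric] add_divide_distrib[symmetric] K_def)
    finally have nK: "real n - 1 \<le> exp (K / \<delta>\<^sup>2)"
      using n by linarith
    define S where "S = bouquet (\<delta> / 16) n"
    define w where "w = gaussian_complexity n S"
    have w1: "ennreal (1 / 2) \<le> w"
      unfolding w_def S_def by (rule gaussian_complexity_bouquet_ge[OF n(1)])
    have w2: "w \<le> ennreal b"
      unfolding w_def S_def b_def
      by (rule gaussian_complexity_bouquet_le) (use n(1) nK \<delta> in \<open>auto simp: K_def power_divide\<close>)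
    have i: "\<P>(G in gaussian_matrix m n. uniform_tessellation m n \<delta> S G) \<ge> 0.99"
      if m: "0 < m" "ennreal (c1 / \<delta> ^ 3) * w\<^sup>2 \<le> of_nat m" for m
    proof -
      have "ennreal (c1 / \<delta> ^ 3 * (1 / 2)\<^sup>2) = ennreal (c1 / \<delta> ^ 3) * (ennreal (1 / 2))\<^sup>2"
        using \<delta> by (subst ennreal_mult) (simp_all only: ennreal_power, simp_all add: c1_def K_def)
      also have "\<dots> \<le> ennreal (c1 / \<delta> ^ 3) * w\<^sup>2"
        by (intro mult_left_mono power_mono w1) auto
      also have "\<dots> \<le> ennreal (real m)"
        using m by (simp add: ennreal_of_nat_eq_real_of_nat)
      finally have "c1 / \<delta> ^ 3 * (1 / 2)\<^sup>2 \<le> real m"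
        by (simp add: ennreal_le_iff)
      then have "4 * (K + 7) \<le> m * \<delta> ^ 3"
        using \<delta> by (simp add: c1_def field_simps power2_eq_square)
      then show ?thesis
        unfolding S_def using bouquet_tessellation_succeeds[of \<delta> n K m] \<delta> n(1) nK m by simp
    qed
    have ii: "\<P>(G in gaussian_matrix m n. \<not> uniform_tessellation m n \<delta> S G) \<ge> 0.99"
      if m: "0 < m" "of_nat m \<le> ennreal (c2 / \<delta> ^ 3) * w\<^sup>2" for m
    proof -
      have "ennreal (real m) \<le> ennreal (c2 / \<delta> ^ 3) * w\<^sup>2"
        using m by (simp add: ennreal_of_nat_eq_real_of_nat)
      also have "\<dots> \<le> ennreal (c2 / \<delta> ^ 3) * (ennreal b)\<^sup>2"
        by (intro mult_left_mono power_mono w2) auto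
      also have "\<dots> = ennreal (c2 / \<delta> ^ 3 * b\<^sup>2)"
        using \<delta> c2 b by (subst ennreal_mult) (simp_all add: ennreal_power)
      also have "c2 / \<delta> ^ 3 * b\<^sup>2 = 1 / \<delta> ^ 3"
        using b by (simp add: c2_def)
      finally have "real m \<le> 1 / \<delta> ^ 3"
        using \<delta> by (simp add: ennreal_le_iff)
      then have "m * \<delta> ^ 3 \<le> 1"
        using \<delta> by (simp add: field_simps)
      then show ?thesis
        unfolding S_def using bouquet_tessellation_fails[of \<delta> n m] \<delta> n m by simp
    qed
    have "S \<noteq> {}" "S \<subseteq> unit_sphere n"
      using bouquet_subset_unit_sphere[of n "\<delta> / 16"] n(1) \<delta> by (auto simp: S_def bouquet_def)
    then show ?thesis
      using i ii unfolding w_def by blast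
  qed
  ultimately show ?thesis
    using c2 by (intro exI[of _ "1 / 200"] exI[of _ c1] exI[of _ c2]) auto
qed

end
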